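(* Let $\Gamma=\{g_1,\ldots,g_k\}\subset H^+$ be admissible, let $p=(p_1,\ldots,p_k)$ be a probability distribution on $\Gamma$ with all $p_i>0$, and let $\mu_*$ be the unique invariant probability measure of the operator $P$ corresponding to $(\Gamma,p)$. Let $\phi\in C(\mathbf{S}^1)$. Then for every $x\in\mathbf{S}^1$ there exists a subset $\Omega'\subset\Omega$ with $\mathbb{P}(\Omega')=1$ such that for every $\omega=(i_1,i_2,\ldots)\in\Omega'$ $$\lim_{n\to\infty}\frac{\phi(g_{i_1}(x))+\phi(g_{i_2,i_1}(x))+\cdots+\phi(g_{i_n,i_{n-1},\ldots,i_1}(x))}{n}=\int_{\mathbf{S}^1}\int_{\Gamma}\phi(y)\,dp(g)\,\mu_*(dy).$$
   Context: $\mathbf{S}^1$ is the circle with arc length normalized to total length $1$. $H^+$ is the set of orientation preserving homeomorphisms of $\mathbf{S}^1$. $C(\mathbf{S}^1)$ is the space of continuous real functions on $\mathbf{S}^1$. $\mathcal{M}_{fin}$ is the set of finite Borel measures on $\mathbf{S}^1$. $\Gamma=\{g_1,\ldots,g_k\}\subset H^+$ is a finite collection and $p(g_i)=p_i>0$, $\sum_i p_i=1$. The Markov operator corresponding to $(\Gamma,p)$ is $P:\mathcal{M}_{fin}\to\mathcal{M}_{fin}$, $P\mu=\sum_{i=1}^k p_i\,\mu\circ g_i^{-1}$; a measure $\mu_*$ is invariant if $P\mu_*=\mu_*$. For admissible $\Gamma$ there is exactly one invariant Borel probability measure. $\Gamma$ is admissible if one of its elements, labelled $g_1$, is such that $\{g_1^n(x):n\ge1\}$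 is dense in $\mathbf{S}^1$ for some (and thus all) $x\in\mathbf{S}^1$. $\Omega=\{1,\ldots,k\}^{\mathbb{N}}$ and $\mathbb{P}$ is the product probability measure on $\Omega$ generated by the distribution $(p_1,\ldots,p_k)$ on $\{1,\ldots,k\}$. Notation: $g_{i_n,i_{n-1},\ldots,i_1}=g_{i_n}\circ g_{i_{n-1}}\circ\cdots\circ g_{i_1}$. *)

theory Defs
  imports "HOL-Probability.Probability"
begin

abbreviation S1 :: "complex set" where
  "S1 \<equiv> sphere 0 1"

definition borel_S1 :: "complex measure" where
  "borel_S1 = restrict_space borel S1"

(* With arc length normalized to 1, the covering map of the circle is t |-> cis (2 * pi * t).
   A homeomorphism preserves orientation iff it has an increasing lift under this map;
   its values off the circle are irrelevant. *)
definition orientation_preserving_homeo :: "(complex \<Rightarrow> complex) \<Rightarrow> bool" where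
  "orientation_preserving_homeo g \<longleftrightarrow>
     (\<exists>h. homeomorphism S1 S1 g h) \<and>
     (\<exists>F :: real \<Rightarrow> real. continuous_on UNIV F \<and> strict_mono F \<and>
        (\<forall>t. F (t + 1) = F t + 1) \<and>
        (\<forall>t. g (cis (2 * pi * t)) = cis (2 * pi * F t)))"

(* The element with a dense forward orbit may carry any index, not necessarily 1. *)
definition admissible :: "nat \<Rightarrow> (nat \<Rightarrow> complex \<Rightarrow> complex) \<Rightarrow> bool" where
  "admissible k g \<longleftrightarrow>
     (\<exists>i\<in>{1..k}. \<exists>x\<in>S1. S1 \<subseteq> closure {(g i ^^ n) x | n. n \<ge> 1})"

definition markov_op ::
  "nat \<Rightarrow> (nat \<Rightarrow> complex \<Rightarrow> complex) \<Rightarrow> (nat \<Rightarrow> real) \<Rightarrow> complex measure \<Rightarrow> complex measure" where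
  "markov_op k g p \<mu> =
     measure_of (space borel_S1) (sets borel_S1)
       (\<lambda>A. \<Sum>i\<in>{1..k}. ennreal (p i) * emeasure (distr \<mu> borel_S1 (g i)) A)"

lemma sets_markov_op [simp]: "sets (markov_op k g p \<mu>) = sets borel_S1"
  by (simp add: markov_op_def)

lemma emeasure_markov_op:
  assumes "A \<in> sets borel_S1"
  shows "emeasure (markov_op k g p \<mu>) A =
    (\<Sum>i\<in>{1..k}. ennreal (p i) * emeasure (distr \<mu> borel_S1 (g i)) A)"
proof (rule emeasure_measure_of[OF markov_op_def])
  show "sets borel_S1 \<subseteq> Pow (space borel_S1)"
    by (rule sets.space_closed)
  show "positive (sets (markov_op k g p \<mu>))
     (\<lambda>A. \<Sum>i\<in>{1..k}. ennreal (p i) * emeasure (distr \<mu> borel_S1 (g i)) A)"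
    by (simp add: positive_def)
  show "countably_additive (sets (markov_op k g p \<mu>))
     (\<lambda>A. \<Sum>i\<in>{1..k}. ennreal (p i) * emeasure (distr \<mu> borel_S1 (g i)) A)"
    by (rule countably_additiveI) (simp add: suminf_sum suminf_emeasure)
qed (simp add: assms)

definition index_dist :: "nat \<Rightarrow> (nat \<Rightarrow> real) \<Rightarrow> nat measure" where
  "index_dist k p = point_measure {1..k} (\<lambda>i. ennreal (p i))"

(* The sample (i_1, i_2, ...) is encoded as \<omega> with \<omega> n = i_{n+1}. *)
definition path_measure :: "nat \<Rightarrow> (nat \<Rightarrow> real) \<Rightarrow> (nat \<Rightarrow> nat) measure" where
  "path_measure k p = PiM UNIV (\<lambda>_. index_dist k p)"

(* word_comp g \<omega> n = g_{i_n} o ... o g_{i_1} *)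
primrec word_comp ::
  "(nat \<Rightarrow> complex \<Rightarrow> complex) \<Rightarrow> (nat \<Rightarrow> nat) \<Rightarrow> nat \<Rightarrow> complex \<Rightarrow> complex" where
  "word_comp g \<omega> 0 = id"
| "word_comp g \<omega> (Suc n) = g (\<omega> n) \<circ> word_comp g \<omega> n"

end

theory Submission
  imports Defs "HOL-Real_Asymp.Real_Asymp"
begin

text \<open>
  Let \<open>U f = (\<Sum>i. p i * f \<circ> g i)\<close>. Lifting the maps to \<open>G i\<close> on the real line, a compactness argument
  yields a monotone \<open>F\<close> with \<open>F (t + 1) = F t + 1\<close> and \<open>(\<Sum>i. p i * F (G i t)) = F t + c\<close>: it is the
  distribution function of a stationary measure of the inverse maps. For a single map with a dense
  orbit the same statement gives a conjugacy with an irrational rotation, hence minimality.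
  Minimality and a maximum principle make \<open>F\<close> continuous and strictly increasing, so that
  \<open>F t - F s\<close> measures distances in a way that \<open>U\<close> preserves on average. Consequently the iterates
  of \<open>U\<close> on a continuous function are equicontinuous, cluster points of their Cesaro means are
  \<open>U\<close>-invariant, and by the maximum principle they are constant. Thus any continuous \<open>\<phi>\<close> is, up to a
  small uniform error and the constant \<open>\<integral>\<phi> d\<mu>\<close>, a coboundary \<open>f - U f\<close>; its sums along
  the random orbit form a martingale with bounded increments up to a bounded term, and an
  exponential moment bound with the Borel-Cantelli lemma finishes the proof.
\<close>

section \<open>Averaging operators and harmonic functions of degree one\<close>

text \<open>By Tychonoff the product of the intervals from \<open>- B t\<close> to
  \<open>B t\<close> is compact. Since the index set may be uncountable, a filter finer than
  \<open>sequentially\<close> takes the place of a subsequence.\<close>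

lemma pointwise_cluster_point:
  fixes a :: "nat \<Rightarrow> 'b \<Rightarrow> real"
  assumes "\<And>n t. \<bar>a n t\<bar> \<le> B t"
  obtains L l where "L \<noteq> bot" "L \<le> sequentially" "\<And>t. ((\<lambda>n. a n t) \<longlongrightarrow> l t) L"
proof -
  define K where "K = PiE UNIV (\<lambda>t. {- B t..B t})"
  have "compactin (product_topology (\<lambda>i. euclidean) UNIV) K"
    unfolding K_def compactin_PiE by auto
  then have "compact K"
    by (simp add: euclidean_product_topology)
  moreover have "eventually (\<lambda>x. x \<in> K) (filtermap a sequentially)"
  proof -
    have "a n \<in> K" for n
      using assms[of n] by (auto simp: K_def abs_le_iff minus_le_iff)
    then show ?thesis by (simp add: eventually_filtermap)
  qed
  ultimately obtain l where l: "inf (nhds l) (filtermap a sequentially) \<noteq> bot"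
    unfolding compact_filter by (metis filtermap_bot_iff trivial_limit_sequentially)
  \<comment> \<open>The neighbourhoods of \<open>l\<close>, pulled back along \<open>a\<close> and
    restricted to large \<open>n\<close>; this filter is proper precisely because \<open>l\<close>
    is a cluster point.\<close>
  define L where "L = inf (filtercomap a (nhds l)) sequentially"
  have "L \<noteq> bot"
  proof
    assume "L = bot"
    then obtain Q R where QR: "eventually Q (filtercomap a (nhds l))" "eventually R sequentially"
      "\<And>n. Q n \<Longrightarrow> \<not> R n"
      unfolding L_def trivial_limit_def eventually_inf by auto
    then obtain Q' where Q': "eventually Q' (nhds l)" "\<And>n. Q' (a n) \<Longrightarrow> Q n"
      by (auto simp: eventually_filtercomap)
    have "eventually (\<lambda>y. \<not> Q' y) (filtermap a sequentially)"
      unfolding eventually_filtermap using QR(2) by eventually_elim (use QR Q' in blast)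
    with Q' have "eventually (\<lambda>_. False) (inf (nhds l) (filtermap a sequentially))"
      unfolding eventually_inf by blast
    with l show False by (simp add: trivial_limit_def)
  qed
  moreover have "L \<le> sequentially" by (simp add: L_def)
  moreover have "((\<lambda>n. a n t) \<longlongrightarrow> l t) L" for t
  proof -
    have "filterlim a (nhds l) L"
      by (simp add: L_def filterlim_def le_infI1 filtermap_le_iff_le_filtercomap)
    then show ?thesis
      by (rule continuous_on_tendsto_compose[OF continuous_on_product_coordinates]) simp_all
  qed
  ultimately show ?thesis using that by blast
qed

section \<open>Monotone functions of degree one\<close>

text \<open>Jumps and flat pieces are allowed, so that distribution functions of arbitrary
  probability measures on the circle, and pointwise limits of such functions, are included.\<close>

definition degree_one :: "(real \<Rightarrow> real) \<Rightarrow> bool" where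
  "degree_one F \<longleftrightarrow> mono F \<and> (\<forall>t. F (t + 1) = F t + 1)"

text \<open>Used with \<open>c = 1\<close> for functions of degree one and with \<open>c = 0\<close>
  for periodic functions.\<close>

lemma periodic_add_int:
  fixes F :: "real \<Rightarrow> real"
  assumes "\<And>t. F (t + 1) = F t + c"
  shows "F (t + of_int m) = F t + c * of_int m"
proof (induction m rule: int_induct[where k=0])
  case base then show ?case by simp
next
  case (step1 i) then show ?case using assms[of "t + of_int i"] by (simp add: algebra_simps)
next
  case (step2 i) then show ?case using assms[of "t + of_int (i - 1)"] by (simp add: algebra_simps)
qed

lemma degree_one_mono: "degree_one F \<Longrightarrow> s \<le> t \<Longrightarrow> F s \<le> F t"
  by (simp add: degree_one_def monoD)

lemma degree_one_add_int: "degree_one F \<Longrightarrow> F (t + of_int m) = F t + of_int m"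
  using periodic_add_int[of F 1] by (simp add: degree_one_def)

text \<open>Rounding the distance up to an integer costs at most 1. The bound is uniform in
  \<open>F\<close>, which makes compactness available.\<close>

lemma degree_one_bound:
  assumes "degree_one F"
  shows "\<bar>F t - F s\<bar> \<le> \<bar>t - s\<bar> + 1"
proof -
  have "F u - F v \<le> u - v + 1" if "v \<le> u" for u v
  proof -
    have "F u \<le> F (v + of_int \<lceil>u - v\<rceil>)"
      by (rule degree_one_mono[OF assms]) linarith
    also have "\<dots> = F v + of_int \<lceil>u - v\<rceil>"
      by (rule degree_one_add_int[OF assms])
    finally show ?thesis by linarith
  qed
  from this[of s t] this[of t s] degree_one_mono[OF assms, of s t] degree_one_mono[OF assms, of t s]
  show ?thesis by (cases "s \<le> t") auto
qed

section \<open>Averaging operators and their Cesaro means\<close>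

text \<open>The Markov operator acting on functions, dual to \<open>markov_op\<close>. The type of
  points is left open because the operator is used both on the circle and on the line of
  lifts.\<close>

definition avg_op :: "'i set \<Rightarrow> ('i \<Rightarrow> real) \<Rightarrow> ('i \<Rightarrow> 'a \<Rightarrow> 'a) \<Rightarrow> ('a \<Rightarrow> real) \<Rightarrow> 'a \<Rightarrow> real" where
  "avg_op I p G f x = (\<Sum>i\<in>I. p i * f (G i x))"

definition cesaro :: "'i set \<Rightarrow> ('i \<Rightarrow> real) \<Rightarrow> ('i \<Rightarrow> 'a \<Rightarrow> 'a) \<Rightarrow> nat \<Rightarrow> ('a \<Rightarrow> real) \<Rightarrow> 'a \<Rightarrow> real" where
  "cesaro I p G n f x = (\<Sum>j<n. (avg_op I p G ^^ j) f x) / real n"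

lemma avg_op_diff: "avg_op I p G (\<lambda>x. f x - h x) y = avg_op I p G f y - avg_op I p G h y"
  by (simp add: avg_op_def algebra_simps sum_subtractf)

lemma avg_op_const: "sum p I = 1 \<Longrightarrow> avg_op I p G (\<lambda>x. c) y = c"
  by (simp add: avg_op_def flip: sum_distrib_right)

lemma avg_op_sum: "avg_op I p G (\<lambda>x. \<Sum>j\<in>J. f j x) y = (\<Sum>j\<in>J. avg_op I p G (f j) y)"
  unfolding avg_op_def by (subst sum.swap) (simp add: sum_distrib_left)

lemma avg_op_divide: "avg_op I p G (\<lambda>x. f x / c) y = avg_op I p G f y / c"
  by (simp add: avg_op_def sum_divide_distrib)

text \<open>The sum telescopes. For bounded iterates the right side tends to 0, which makes cluster
  points of the Cesaro means invariant.\<close>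

lemma avg_op_cesaro:
  "avg_op I p G (cesaro I p G n f) x - cesaro I p G n f x = ((avg_op I p G ^^ n) f x - f x) / real n"
proof -
  have "avg_op I p G (cesaro I p G n f) x = (\<Sum>j<n. (avg_op I p G ^^ Suc j) f x) / real n"
    unfolding cesaro_def avg_op_divide avg_op_sum by simp
  then have "avg_op I p G (cesaro I p G n f) x - cesaro I p G n f x
      = (\<Sum>j<n. (avg_op I p G ^^ Suc j) f x - (avg_op I p G ^^ j) f x) / real n"
    unfolding cesaro_def by (simp add: sum_subtractf diff_divide_distrib)
  also have "\<dots> = ((avg_op I p G ^^ n) f x - f x) / real n"
    unfolding sum_lessThan_telescope[of "\<lambda>j. (avg_op I p G ^^ j) f x"] by simp
  finally show ?thesis .
qed

lemma avg_op_tendsto: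
  assumes "\<And>i. i \<in> I \<Longrightarrow> ((\<lambda>n. a n (G i x)) \<longlongrightarrow> l (G i x)) L"
  shows "((\<lambda>n. avg_op I p G (a n) x) \<longlongrightarrow> avg_op I p G l x) L"
  unfolding avg_op_def by (intro tendsto_intros assms)

lemma avg_op_abs_le:
  assumes "\<And>i. i \<in> I \<Longrightarrow> 0 \<le> p i" "sum p I = 1" "\<And>i. i \<in> I \<Longrightarrow> \<bar>f (G i x)\<bar> \<le> B"
  shows "\<bar>avg_op I p G f x\<bar> \<le> B"
proof -
  have "\<bar>avg_op I p G f x\<bar> \<le> (\<Sum>i\<in>I. p i * B)"
    unfolding avg_op_def using assms
    by (intro order_trans[OF sum_abs] sum_mono) (auto simp: abs_mult intro: mult_left_mono)
  then show ?thesis using assms(2) by (simp flip: sum_distrib_right)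
qed

lemma degree_one_avg_op:
  assumes "\<And>i. i \<in> I \<Longrightarrow> 0 \<le> p i" "sum p I = 1" "\<And>i. i \<in> I \<Longrightarrow> degree_one (G i)" "degree_one F"
  shows "degree_one (avg_op I p G F)"
proof -
  have "mono (avg_op I p G F)"
    unfolding avg_op_def using assms
    by (intro monoI sum_mono mult_left_mono) (auto intro: degree_one_mono)
  moreover have "avg_op I p G F (t + 1) = avg_op I p G F t + 1" for t
  proof -
    have "avg_op I p G F (t + 1) = (\<Sum>i\<in>I. p i * (F (G i t) + 1))"
      unfolding avg_op_def using assms(3,4) by (intro sum.cong) (auto simp: degree_one_def)
    then show ?thesis using assms(2) by (simp add: avg_op_def distrib_left sum.distrib)
  qed
  ultimately show ?thesis by (simp add: degree_one_def)
qed

text \<open>A Krylov-Bogoliubov argument: the iterates of the identity may drift to infinity, but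
  after subtracting their value at 0 they are bounded at each point, and a cluster point of their
  Cesaro means solves the equation.\<close>

lemma exists_harmonic_degree_one:
  assumes "\<And>i. i \<in> I \<Longrightarrow> 0 \<le> p i" "sum p I = 1" "\<And>i. i \<in> I \<Longrightarrow> degree_one (G i)"
  obtains F c where "degree_one F" "\<And>t. avg_op I p G F t = F t + c"
proof -
  let ?V = "avg_op I p G"
  define e where "e = (\<lambda>n. (?V ^^ n) id)"
  define d where "d = (\<lambda>n t. e n t - e n 0)"
  define a where "a = (\<lambda>n t. (\<Sum>j<n. d j t) / real n)"
  have e: "degree_one (e n)" for n
  proof (induction n)
    case 0 show ?case by (simp add: e_def degree_one_def mono_def)
  next
    case (Suc n) then show ?case using degree_one_avg_op[OF assms] by (simp add: e_def)
  qed
  have d_bound: "\<bar>d n t\<bar> \<le> \<bar>t\<bar> + 1" for n t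
    using degree_one_bound[OF e, of n t 0] by (simp add: d_def)
  have "\<bar>a n t\<bar> \<le> \<bar>t\<bar> + 1" for n t
  proof (cases "n = 0")
    case False
    have "\<bar>\<Sum>j<n. d j t\<bar> \<le> (\<Sum>j<n. \<bar>t\<bar> + 1)"
      by (intro order_trans[OF sum_abs] sum_mono d_bound)
    then show ?thesis using False by (simp add: a_def field_simps)
  qed (simp add: a_def)
  from pointwise_cluster_point[of a, OF this]
  obtain L F where L: "L \<noteq> bot" "L \<le> sequentially" and F: "\<And>t. ((\<lambda>n. a n t) \<longlongrightarrow> F t) L"
    by metis
  have ev: "eventually P L" if "eventually P sequentially" for P
    using that L(2) by (simp add: filter_leD)
  have "mono F"
  proof (rule monoI)
    fix s t :: real assume "s \<le> t"
    then have "a n s \<le> a n t" for n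
      using degree_one_mono[OF e] by (auto simp: a_def d_def intro!: divide_right_mono sum_mono)
    then show "F s \<le> F t" by (intro tendsto_le[OF L(1) F F]) simp
  qed
  moreover have "F (t + 1) = F t + 1" for t
  proof (rule tendsto_unique[OF L(1) F])
    have "eventually (\<lambda>n. a n t + 1 = a n (t + 1)) sequentially"
      using eventually_gt_at_top[of 0]
    proof eventually_elim
      case (elim n)
      have "d j (t + 1) = d j t + 1" for j using e[of j] by (simp add: d_def degree_one_def)
      then show ?case using elim by (simp add: a_def sum.distrib add_divide_distrib)
    qed
    then show "((\<lambda>n. a n (t + 1)) \<longlongrightarrow> F t + 1) L"
      by (intro Lim_transform_eventually[OF tendsto_add[OF F tendsto_const]] ev)
  qed
  moreover have fixed: "?V F t - ?V F 0 - F t = 0" for t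
  proof (rule tendsto_unique[OF L(1)])
    show "((\<lambda>n. ?V (a n) t - ?V (a n) 0 - a n t) \<longlongrightarrow> ?V F t - ?V F 0 - F t) L"
      by (intro tendsto_intros avg_op_tendsto F)
    \<comment> \<open>Averaging commutes with adding constants, so averaging and renormalising at 0
      moves \<open>d j\<close> to \<open>d (Suc j)\<close>; the Cesaro sum then telescopes.\<close>
    have Vd: "?V (d j) t - ?V (d j) 0 = d (Suc j) t" for j
      unfolding d_def avg_op_diff by (simp add: e_def avg_op_const[OF assms(2)])
    have "?V (a n) t - ?V (a n) 0 - a n t = (d n t - d 0 t) / real n" for n
    proof -
      have "?V (a n) t - ?V (a n) 0 - a n t = (\<Sum>j<n. ?V (d j) t - ?V (d j) 0 - d j t) / real n"
        unfolding a_def avg_op_divide avg_op_sum by (simp add: sum_subtractf diff_divide_distrib)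
      also have "\<dots> = (d n t - d 0 t) / real n"
        unfolding Vd sum_lessThan_telescope[of "\<lambda>j. d j t"] ..
      finally show ?thesis .
    qed
    moreover have "(\<lambda>n. (d n t - d 0 t) / real n) \<longlonglongrightarrow> 0"
    proof (rule Lim_null_comparison)
      have "norm ((d n t - d 0 t) / real n) \<le> 2 * (\<bar>t\<bar> + 1) / real n" for n
        using d_bound[of n t] d_bound[of 0 t] by (auto simp: abs_divide intro!: divide_right_mono)
      then show "eventually (\<lambda>n. norm ((d n t - d 0 t) / real n) \<le> 2 * (\<bar>t\<bar> + 1) / real n) sequentially"
        by simp
      show "(\<lambda>n. 2 * (\<bar>t\<bar> + 1) / real n) \<longlonglongrightarrow> 0" by real_asymp
    qed
    ultimately show "((\<lambda>n. ?V (a n) t - ?V (a n) 0 - a n t) \<longlongrightarrow> 0) L"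
      using tendsto_mono[OF L(2)] by simp
  qed
  ultimately have "degree_one F" by (simp add: degree_one_def)
  moreover have "?V F t = F t + ?V F 0" for t using fixed[of t] by argo
  ultimately show ?thesis by (rule that)
qed

section \<open>Circle homeomorphisms with a dense orbit\<close>

definition circ :: "real \<Rightarrow> complex" where
  "circ t = cis (2 * pi * t)"

lemma circ_eq_iff: "circ s = circ t \<longleftrightarrow> (\<exists>m::int. s = t + of_int m)"
proof -
  have "circ s = circ t \<longleftrightarrow> (\<exists>m::int. 2 * pi * s = 2 * pi * t + 2 * pi * of_int m)"
    using sin_cos_eq_iff[of "2 * pi * s" "2 * pi * t"] by (auto simp: circ_def complex_eq_iff)
  also have "\<dots> \<longleftrightarrow> (\<exists>m::int. 2 * pi * s = 2 * pi * (t + of_int m))"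
    by (simp add: distrib_left)
  finally show ?thesis by simp
qed

lemma circ_add_int [simp]: "circ (t + of_int m) = circ t"
  by (auto simp: circ_eq_iff)

lemma norm_circ [simp]: "norm (circ t) = 1"
  by (simp add: circ_def)

lemma circ_in_S1: "circ t \<in> sphere 0 1"
  by simp

lemma continuous_on_circ: "continuous_on A circ"
  unfolding circ_def cis_conv_exp by (intro continuous_intros)

lemma S1_circ:
  assumes "x \<in> sphere 0 1"
  obtains t where "0 \<le> t" "t < 1" "x = circ t"
proof -
  have "x = cis (Arg x)" using assms cis_Arg[of x] by (cases "x = 0") (auto simp: sgn_div_norm)
  then have "x = circ (Arg x / (2 * pi))" by (simp add: circ_def)
  moreover have "circ (frac (Arg x / (2 * pi))) = circ (Arg x / (2 * pi))"
    using circ_add_int[of "Arg x / (2 * pi)" "- \<lfloor>Arg x / (2 * pi)\<rfloor>"] by (simp add: frac_def)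
  ultimately show ?thesis using that[of "frac (Arg x / (2 * pi))"] frac_lt_1 frac_ge_0 by metis
qed

text \<open>The direction of the first step persists under a monotone map, so the orbit is a bounded
  monotone sequence; continuity makes its limit a fixed point.\<close>

lemma monotone_orbit_convergent:
  fixes T :: "real \<Rightarrow> real"
  assumes "mono T" "continuous_on UNIV T" "\<And>n. a \<le> (T ^^ n) x" "\<And>n. (T ^^ n) x \<le> b"
  obtains l where "(\<lambda>n. (T ^^ n) x) \<longlonglongrightarrow> l" "T l = l"
proof -
  have "monoseq (\<lambda>n. (T ^^ n) x)"
  proof (cases "x \<le> T x")
    case True
    have "(T ^^ n) x \<le> (T ^^ Suc n) x" for n
      by (induction n) (use True \<open>mono T\<close> in \<open>auto dest: monoD\<close>)
    then show ?thesis unfolding monoseq_Suc by blast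
  next
    case False
    have "(T ^^ Suc n) x \<le> (T ^^ n) x" for n
      by (induction n) (use False \<open>mono T\<close> in \<open>auto dest: monoD\<close>)
    then show ?thesis unfolding monoseq_Suc by blast
  qed
  moreover have "Bseq (\<lambda>n. (T ^^ n) x)"
  proof (rule BseqI')
    show "norm ((T ^^ n) x) \<le> \<bar>a\<bar> + \<bar>b\<bar>" for n using assms(3,4)[of n] by auto
  qed
  ultimately obtain l where l: "(\<lambda>n. (T ^^ n) x) \<longlonglongrightarrow> l"
    using Bseq_monoseq_convergent convergentD by blast
  moreover have "(\<lambda>n. T ((T ^^ n) x)) \<longlonglongrightarrow> T l"
    by (rule continuous_on_tendsto_compose[OF assms(2) l]) auto
  then have "(\<lambda>n. (T ^^ n) x) \<longlonglongrightarrow> T l"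
    by (subst filterlim_sequentially_Suc[symmetric]) simp
  ultimately show ?thesis using that LIMSEQ_unique by metis
qed

definition circle_lift :: "(real \<Rightarrow> real) \<Rightarrow> bool" where
  "circle_lift G \<longleftrightarrow> continuous_on UNIV G \<and> strict_mono G \<and> (\<forall>t. G (t + 1) = G t + 1)"

lemma circle_lift_degree_one: "circle_lift G \<Longrightarrow> degree_one G"
  by (simp add: circle_lift_def degree_one_def strict_mono_mono)

lemma circle_lift_funpow:
  assumes "circle_lift G"
  shows "circle_lift (G ^^ n)"
proof (induction n)
  case 0 show ?case by (simp add: circle_lift_def strict_mono_def)
next
  case (Suc n)
  have "continuous_on UNIV (G \<circ> (G ^^ n))"
    using assms Suc by (intro continuous_on_compose) (auto simp: circle_lift_def intro: continuous_on_subset)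
  then show ?case using assms Suc by (simp add: circle_lift_def strict_mono_def)
qed

lemma circ_funpow:
  assumes "\<And>t. g (circ t) = circ (G t)"
  shows "(g ^^ n) (circ t) = circ ((G ^^ n) t)"
  by (induction n) (simp_all add: assms)

section \<open>A homeomorphism with a dense orbit: conjugacy with a rotation and minimality\<close>

locale transitive_lift =
  fixes g :: "complex \<Rightarrow> complex" and G :: "real \<Rightarrow> real" and x :: complex
  assumes lift: "circle_lift G" and lift_circ: "\<And>t. g (circ t) = circ (G t)"
    and x: "x \<in> sphere 0 1" and dense: "sphere 0 1 \<subseteq> closure {(g ^^ n) x | n. n \<ge> 1}"
begin

text \<open>If \<open>G\<close> had a periodic point, the orbit of \<open>x\<close> would split into finitely many convergent
  sequences, so its closure would be countable.\<close>

lemma no_periodic_point: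
  assumes "q \<ge> 1"
  shows "(G ^^ q) y \<noteq> y + of_int r"
proof
  assume y: "(G ^^ q) y = y + of_int r"
  \<comment> \<open>Removing the integer \<open>r\<close> makes \<open>y\<close>, and with it every
    integer translate of \<open>y\<close>, a fixed point.\<close>
  define T where "T = (\<lambda>t. (G ^^ q) t - of_int r)"
  have Gq: "circle_lift (G ^^ n)" for n by (rule circle_lift_funpow[OF lift])
  have T: "degree_one T" "continuous_on UNIV T"
    using Gq[of q] circle_lift_degree_one[OF Gq[of q]]
    by (auto simp: T_def degree_one_def circle_lift_def mono_def intro!: continuous_intros)
  obtain u where u: "x = circ u" using S1_circ[OF x] by blast
  define m where "m = \<lfloor>u - y\<rfloor>"
  have Ty: "T (y + of_int k) = y + of_int k" for k
    using y degree_one_add_int[OF T(1)] by (simp add: T_def)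
  \<comment> \<open>Monotonicity traps the orbit of \<open>u\<close> under \<open>T\<close> between
    two neighbouring fixed points.\<close>
  have b: "y + of_int m \<le> (T ^^ n) u \<and> (T ^^ n) u \<le> y + of_int (m + 1)" for n
  proof (induction n)
    case 0 show ?case unfolding m_def by simp linarith
  next
    case (Suc n)
    then show ?case
      using degree_one_mono[OF T(1), of "y + of_int m" "(T ^^ n) u"]
        degree_one_mono[OF T(1), of "(T ^^ n) u" "y + of_int (m + 1)"] unfolding Ty by simp
  qed
  have "mono T" using T(1) by (simp add: degree_one_def)
  then obtain l where l: "(\<lambda>n. (T ^^ n) u) \<longlonglongrightarrow> l"
    using monotone_orbit_convergent[OF _ T(2)] b by metis
  have T_funpow: "\<exists>k::int. (G ^^ (q * n)) u = (T ^^ n) u + of_int k" for n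
  proof (induction n)
    case 0 show ?case by (auto intro!: exI[of _ 0])
  next
    case (Suc n)
    then obtain k :: int where k: "(G ^^ (q * n)) u = (T ^^ n) u + of_int k" by blast
    have "(G ^^ (q * Suc n)) u = (G ^^ q) ((T ^^ n) u + of_int k)"
      by (simp add: funpow_add k)
    also have "\<dots> = (T ^^ Suc n) u + of_int (k + r)"
      using degree_one_add_int[OF circle_lift_degree_one[OF Gq]] by (simp add: T_def)
    finally show ?case by blast
  qed
  define z where "z = (\<lambda>s n. circ ((G ^^ s) ((T ^^ n) u)))"
  have z_lim: "z s \<longlonglongrightarrow> circ ((G ^^ s) l)" for s
    unfolding z_def using Gq[of s]
    by (intro continuous_on_tendsto_compose[OF continuous_on_circ[of UNIV]]
        continuous_on_tendsto_compose[OF _ l, of UNIV]) (auto simp: circle_lift_def)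
  \<comment> \<open>One convergent sequence with its limit for each residue of the time modulo
    \<open>q\<close>: a closed countable set containing the whole orbit.\<close>
  define Z where "Z = (\<Union>s<q. insert (circ ((G ^^ s) l)) (range (z s)))"
  have "(g ^^ n) x \<in> Z" for n
  proof -
    have "n = n mod q + q * (n div q)" by simp
    then have "(G ^^ n) u = (G ^^ (n mod q)) ((G ^^ (q * (n div q))) u)"
      by (metis funpow_add comp_apply)
    then obtain k :: int where "(G ^^ n) u = (G ^^ (n mod q)) ((T ^^ (n div q)) u + of_int k)"
      using T_funpow by metis
    then have "(G ^^ n) u = (G ^^ (n mod q)) ((T ^^ (n div q)) u) + of_int k"
      by (simp add: degree_one_add_int[OF circle_lift_degree_one[OF Gq]])
    then have "(g ^^ n) x = z (n mod q) (n div q)"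
      by (simp add: u z_def circ_funpow[of g G] lift_circ)
    moreover have "n mod q < q" using assms by simp
    ultimately show ?thesis by (auto simp: Z_def)
  qed
  moreover have "closed Z"
    unfolding Z_def
    by (intro closed_UN ballI compact_imp_closed compact_sequence_with_limit z_lim) auto
  ultimately have "closure {(g ^^ n) x | n. n \<ge> 1} \<subseteq> Z"
    by (intro closure_minimal) auto
  then have "sphere (0::complex) 1 \<subseteq> Z" using dense by blast
  moreover have "countable Z" unfolding Z_def by auto
  moreover have "uncountable (sphere (0::complex) 1)"
    by (rule connected_uncountable[of _ 1 "-1"]) (auto intro: connected_sphere)
  ultimately show False using countable_subset by blast
qed

text \<open>If every translate of the orbit missed the interval, the orbit would stay in a compact
  arc that omits the midpoint of the gap, against density.\<close>

lemma visits:
  assumes "circ u = x" "s < t"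
  obtains n m where "s < (G ^^ n) u + of_int m" "(G ^^ n) u + of_int m < t"
proof (rule ccontr)
  assume "\<not> thesis"
  then have no: "\<not> (s < (G ^^ n) u + of_int m \<and> (G ^^ n) u + of_int m < t)" for n m
    using that by blast
  \<comment> \<open>Caps the gap at one full turn, so that \<open>{t'..s + 1}\<close> represents the
    complementary arc.\<close>
  define t' where "t' = min t (s + 1)"
  have "(g ^^ n) x \<in> circ ` {t'..s + 1}" for n
  proof -
    \<comment> \<open>The translate of the orbit point that lies in the fundamental domain from
      \<open>s\<close> (excluded) to \<open>s + 1\<close> (included).\<close>
    define v where "v = (G ^^ n) u + of_int (- \<lceil>(G ^^ n) u - s\<rceil> + 1)"
    have "s < v" "v \<le> s + 1" unfolding v_def by (simp; linarith)+
    with no[of n "- \<lceil>(G ^^ n) u - s\<rceil> + 1"] have "v \<in> {t'..s + 1}"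
      by (auto simp: v_def t'_def)
    moreover have "(g ^^ n) x = circ v"
      unfolding v_def circ_add_int assms(1)[symmetric] by (rule circ_funpow) (rule lift_circ)
    ultimately show ?thesis by blast
  qed
  moreover have "closed (circ ` {t'..s + 1})"
    by (intro compact_imp_closed compact_continuous_image continuous_on_circ) simp
  ultimately have "closure {(g ^^ n) x | n. n \<ge> 1} \<subseteq> circ ` {t'..s + 1}"
    by (intro closure_minimal) auto
  then have "circ ((s + t') / 2) \<in> circ ` {t'..s + 1}"
    using dense circ_in_S1 by blast
  then obtain w where w: "circ ((s + t') / 2) = circ w" "w \<in> {t'..s + 1}"
    by (rule imageE)
  then have w': "t' \<le> w" "w \<le> s + 1" by simp_all
  from w(1) obtain m :: int where m: "(s + t') / 2 = w + of_int m"
    unfolding circ_eq_iff by (rule exE)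
  then have m: "s + t' = 2 * w + 2 * real_of_int m" by simp
  have "s < t'" "t' \<le> s + 1" using assms(2) by (auto simp: t'_def)
  with w' m have "-1 < real_of_int m" "real_of_int m < 0"
    by argo+
  then have "-1 < m" "m < 0" by simp_all
  then show False by linarith
qed

text \<open>If \<open>\<alpha>\<close> were \<open>r / q\<close>, then \<open>T\<close>, the
  \<open>q\<close>-th iterate minus \<open>r\<close>, would leave \<open>h\<close> unchanged. Hence
  the orbit of 0 under \<open>T\<close> would stay bounded and converge to a fixed point, which is a
  periodic point of the circle map.\<close>

lemma semiconjugacy_irrational:
  assumes h: "degree_one h" "\<And>t. h (G t) = h t + \<alpha>"
  shows "\<alpha> \<notin> \<rat>"
proof
  assume "\<alpha> \<in> \<rat>"
  then obtain r q where q: "q > 0" and \<alpha>: "\<alpha> = of_int r / of_int q"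
    by (rule Rats_cases') 
  define T where "T = (\<lambda>t. (G ^^ nat q) t - of_int r)"
  have Gq: "circle_lift (G ^^ n)" for n by (rule circle_lift_funpow[OF lift])
  have T: "mono T" "continuous_on UNIV T"
    using Gq[of "nat q"] circle_lift_degree_one[OF Gq[of "nat q"]]
    by (auto simp: T_def degree_one_def circle_lift_def mono_def intro!: continuous_intros)
  have hG: "h ((G ^^ n) t) = h t + real n * \<alpha>" for n t
    by (induction n) (simp_all add: h(2) algebra_simps)
  have hT: "h (T t) = h t" for t
    using degree_one_add_int[OF h(1), of "(G ^^ nat q) t" "- r"] hG[of "nat q" t] q
    by (simp add: T_def \<alpha>)
  have hTn: "h ((T ^^ n) 0) = h 0" for n by (induction n) (simp_all add: hT)
  \<comment> \<open>Outside this interval \<open>h\<close> would differ from \<open>h 0\<close> by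
    at least 1.\<close>
  have bound: "-1 \<le> (T ^^ n) 0 \<and> (T ^^ n) 0 \<le> 1" for n
    using degree_one_mono[OF h(1), of "(T ^^ n) 0" "-1"] degree_one_mono[OF h(1), of 1 "(T ^^ n) 0"]
      hTn[of n] degree_one_add_int[OF h(1), of 0 "-1"] degree_one_add_int[OF h(1), of 0 1]
    by force
  obtain l where "T l = l"
    using monotone_orbit_convergent[OF T, of "-1" 0 1] bound by metis
  then show False using no_periodic_point[of "nat q" l r] q by (simp add: T_def algebra_simps)
qed

text \<open>The orbit of \<open>x\<close> visits both halves of a flat interval, necessarily at
  different times. Equality of the two values of \<open>h\<close> then expresses
  \<open>\<alpha>\<close> as a quotient of integers.\<close>

lemma semiconjugacy_strict_mono:
  assumes h: "degree_one h" "\<And>t. h (G t) = h t + \<alpha>"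
  shows "strict_mono h"
proof (rule ccontr)
  assume "\<not> strict_mono h"
  then obtain s t where st: "s < t" "h s = h t"
    using degree_one_mono[OF h(1)] unfolding strict_mono_def by (meson less_eq_real_def not_less)
  obtain u where u: "circ u = x" using S1_circ[OF x] by metis
  define v where "v = (s + t) / 2"
  obtain n m where n: "s < (G ^^ n) u + of_int m" "(G ^^ n) u + of_int m < v"
    using visits[OF u, of s v] st by (auto simp: v_def)
  obtain n' m' where n': "v < (G ^^ n') u + of_int m'" "(G ^^ n') u + of_int m' < t"
    using visits[OF u, of v t] st by (auto simp: v_def)
  have hG: "h ((G ^^ n) t + of_int m) = h t + real n * \<alpha> + of_int m" for n t m
    unfolding degree_one_add_int[OF h(1)] by (induction n) (simp_all add: h(2) algebra_simps)
  have const: "h w = h s" if "s < w" "w < t" for w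
    using degree_one_mono[OF h(1), of s w] degree_one_mono[OF h(1), of w t] that st by simp
  have eq: "real n * \<alpha> + of_int m = real n' * \<alpha> + of_int m'"
    using const[OF n(1)] const[OF _ n'(2)] n n' st unfolding hG by (simp add: v_def)
  have "n \<noteq> n'"
  proof
    assume "n = n'"
    with eq have "m = m'" by simp
    with \<open>n = n'\<close> n n' show False by simp
  qed
  have "\<alpha> = (of_int m' - of_int m) / (real n - real n')"
    using eq \<open>n \<noteq> n'\<close> by (simp add: field_simps)
  then have "\<alpha> \<in> \<rat>" by simp
  with semiconjugacy_irrational[OF h] show False ..
qed

text \<open>For a single map the harmonic equation is a semiconjugacy with translation by
  \<open>\<alpha>\<close>. Strict monotonicity transports order relations in both
  directions.\<close>

lemma exists_conjugacy:
  obtains h \<alpha> where "degree_one h" "strict_mono h" "\<alpha> \<notin> \<rat>"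
    "\<And>n t m. h ((G ^^ n) t + of_int m) = h t + real n * \<alpha> + of_int m"
proof -
  obtain h \<alpha> where h: "degree_one h" "\<And>t. avg_op {()} (\<lambda>_. 1) (\<lambda>_. G) h t = h t + \<alpha>"
    using exists_harmonic_degree_one[of "{()}" "\<lambda>_. 1" "\<lambda>_. G"] circle_lift_degree_one[OF lift]
    by auto
  then have hG: "h (G t) = h t + \<alpha>" for t by (simp add: avg_op_def)
  have "h ((G ^^ n) t + of_int m) = h t + real n * \<alpha> + of_int m" for n t m
    unfolding degree_one_add_int[OF h(1)] by (induction n) (simp_all add: hG algebra_simps)
  then show ?thesis
    using that h(1) semiconjugacy_strict_mono[OF h(1) hG] semiconjugacy_irrational[OF h(1) hG] by blast
qed

text \<open>Minimality: the positive multiples of the irrational \<open>\<alpha>\<close> are dense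
  modulo 1, so the rotated point \<open>h z\<close> enters the interval from \<open>h s\<close> to
  \<open>h t\<close>; strict monotonicity of \<open>h\<close> brings this back to
  \<open>G\<close>.\<close>

lemma orbit_dense:
  assumes "s < t"
  obtains n m where "s < (G ^^ n) z + of_int m" "(G ^^ n) z + of_int m < t"
proof -
  obtain h \<alpha> where h: "strict_mono h" "\<alpha> \<notin> \<rat>"
    "\<And>n t m. h ((G ^^ n) t + of_int m) = h t + real n * \<alpha> + of_int m"
    using exists_conjugacy by metis
  have "h s < h t" using h(1) assms by (simp add: strict_mono_def)
  then obtain k :: int and m :: int where "k > 0"
    "\<bar>of_int k * \<alpha> - of_int m - ((h s + h t) / 2 - h z)\<bar> < (h t - h s) / 2"
    using sequence_of_fractional_parts_is_dense[OF h(2)] by (metis half_gt_zero diff_gt_0_iff_gt)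
  then have "h s < h z + real (nat k) * \<alpha> + of_int (- m)" "h z + real (nat k) * \<alpha> + of_int (- m) < h t"
    unfolding abs_less_iff by (simp_all add: field_simps)
  then have "s < (G ^^ nat k) z + of_int (- m)" "(G ^^ nat k) z + of_int (- m) < t"
    unfolding h(3)[symmetric] strict_mono_less[OF h(1)] .
  then show ?thesis by (rule that)
qed

text \<open>The same density argument with the interval moving and the point fixed; it will spread a
  flat interval over the whole circle.\<close>

lemma image_covers:
  assumes "s < t"
  obtains n m where "(G ^^ n) s < z + of_int m" "z + of_int m < (G ^^ n) t"
proof -
  obtain h \<alpha> where h: "degree_one h" "strict_mono h" "\<alpha> \<notin> \<rat>"
    "\<And>n t m. h ((G ^^ n) t + of_int m) = h t + real n * \<alpha> + of_int m"
    using exists_conjugacy by metis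
  have "h s < h t" using h(2) assms by (simp add: strict_mono_def)
  then obtain k :: int and m :: int where "k > 0"
    "\<bar>of_int k * \<alpha> - of_int m - (h z - (h s + h t) / 2)\<bar> < (h t - h s) / 2"
    using sequence_of_fractional_parts_is_dense[OF h(3)] by (metis half_gt_zero diff_gt_0_iff_gt)
  then have "h s + real (nat k) * \<alpha> + of_int 0 < h z + of_int m"
    "h z + of_int m < h t + real (nat k) * \<alpha> + of_int 0"
    unfolding abs_less_iff by (simp_all add: field_simps)
  then have "(G ^^ nat k) s + of_int 0 < z + of_int m" "z + of_int m < (G ^^ nat k) t + of_int 0"
    unfolding h(4)[symmetric] degree_one_add_int[OF h(1), symmetric] strict_mono_less[OF h(2)] .
  then show ?thesis using that by simp
qed

end

section \<open>Equidistribution of averaged circle maps\<close>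

text \<open>Without a maximum the open sets where \<open>J\<close> is below some \<open>J s\<close>
  would cover a period. In a finite subcover the largest value \<open>J s\<close> would itself lie
  below another \<open>J r\<close>, a contradiction.\<close>

lemma usc_periodic_attains_sup:
  fixes J :: "real \<Rightarrow> real"
  assumes "\<And>c. open {t. J t < c}" "\<And>t. J (t + 1) = J t"
  obtains a where "\<And>t. J t \<le> J a"
proof (rule ccontr)
  assume "\<not> thesis"
  then have up: "\<exists>s. J t < J s" for t using that not_le by metis
  then have "{0..1} \<subseteq> (\<Union>s\<in>UNIV. {t. J t < J s})" by blast
  then obtain C where C: "finite C" "{0..1} \<subseteq> (\<Union>s\<in>C. {t. J t < J s})"
    using compactE_image[of "{0..1::real}" UNIV "\<lambda>s. {t. J t < J s}"] assms(1) by auto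
  then have "C \<noteq> {}" by auto
  then obtain s where s: "s \<in> C" "J s = Max (J ` C)"
    using C(1) by (metis (mono_tags, lifting) Max_in finite_imageI image_iff image_is_empty)
  have "frac s \<in> {0..1}" by (simp add: frac_lt_1 less_imp_le)
  with C(2) obtain r where r: "r \<in> C" "J (frac s) < J r" by blast
  have "J (frac s) = J s"
    using periodic_add_int[of J 0 s "- \<lfloor>s\<rfloor>"] assms(2) by (simp add: frac_def)
  moreover have "J r \<le> J s" using s(2) C(1) r(1) by simp
  ultimately show False using r(2) by simp
qed

lemma periodic_uniformly_continuous:
  fixes f :: "real \<Rightarrow> real"
  assumes "continuous_on UNIV f" "\<And>t. f (t + 1) = f t" "e > 0"
  obtains d where "d > 0" "\<And>s t. \<bar>s - t\<bar> < d \<Longrightarrow> \<bar>f s - f t\<bar> < e"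
proof -
  \<comment> \<open>Once \<open>s\<close> is moved into \<open>{0..1}\<close>, any point at distance
    less than 1 from it lies in \<open>{-1..2}\<close>.\<close>
  have "uniformly_continuous_on {-1..2} f"
    by (rule compact_uniformly_continuous) (auto intro: continuous_on_subset[OF assms(1)])
  then obtain d where d: "d > 0"
    "\<And>s t. s \<in> {-1..2} \<Longrightarrow> t \<in> {-1..2} \<Longrightarrow> dist s t < d \<Longrightarrow> dist (f s) (f t) < e"
    unfolding uniformly_continuous_on_def using \<open>e > 0\<close> by metis
  have "\<bar>f s - f t\<bar> < e" if "\<bar>s - t\<bar> < min d 1" for s t
  proof -
    define m where "m = - \<lfloor>s\<rfloor>"
    have "s + of_int m \<in> {0..1}" unfolding m_def by simp linarith
    then have "s + of_int m \<in> {-1..2}" "t + of_int m \<in> {-1..2}" using that by auto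
    from d(2)[OF this] have "\<bar>f (s + of_int m) - f (t + of_int m)\<bar> < e"
      using that by (simp add: dist_real_def)
    then show ?thesis using periodic_add_int[of f 0] assms(2) by simp
  qed
  then show ?thesis using that[of "min d 1"] d(1) by simp
qed

lemma periodic_bounded:
  fixes f :: "real \<Rightarrow> real"
  assumes "continuous_on UNIV f" "\<And>t. f (t + 1) = f t"
  obtains B where "\<And>t. \<bar>f t\<bar> \<le> B"
proof -
  have "compact (f ` {0..1})"
    by (intro compact_continuous_image continuous_on_subset[OF assms(1)]) auto
  then have "bounded (f ` {0..1})" by (rule compact_imp_bounded)
  then obtain B where "\<forall>y\<in>f ` {0..1}. norm y \<le> B" unfolding bounded_iff by (rule exE)
  then have B: "\<bar>f t\<bar> \<le> B" if "t \<in> {0..1}" for t using that by simp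
  have "\<bar>f t\<bar> \<le> B" for t
  proof -
    have "f (frac t) = f t"
      using periodic_add_int[of f 0 t "- \<lfloor>t\<rfloor>"] assms(2) by (simp add: frac_def)
    moreover have "frac t \<in> {0..1}" by (simp add: frac_lt_1 less_imp_le)
    ultimately show ?thesis using B by metis
  qed
  then show ?thesis by (rule that)
qed

section \<open>Moduli of continuity measured by a harmonic function\<close>

text \<open>A modulus of continuity that is affine in \<open>F t - F s\<close> is preserved by \<open>U\<close>, since \<open>F\<close> is
  harmonic up to a constant; this yields the equicontinuity of the iterates of \<open>U\<close>.\<close>

definition affine_modulus :: "(real \<Rightarrow> real) \<Rightarrow> real \<Rightarrow> real \<Rightarrow> (real \<Rightarrow> real) \<Rightarrow> bool" where
  "affine_modulus F e C f \<longleftrightarrow> (\<forall>s t. s \<le> t \<longrightarrow> \<bar>f t - f s\<bar> \<le> e + C * (F t - F s))"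

text \<open>Points closer than \<open>d\<close> are handled by uniform continuity with the term
  \<open>e\<close>. Over a distance \<open>d\<close> the function \<open>F\<close> grows by at least
  some \<open>h > 0\<close>, so for the other points the slope \<open>2 * B / h\<close> already
  exceeds the total oscillation of \<open>f\<close>.\<close>

lemma exists_affine_modulus:
  assumes F: "degree_one F" "continuous_on UNIV F" "strict_mono F"
    and f: "continuous_on UNIV f" "\<And>t. f (t + 1) = f t" and "e > 0"
  obtains C where "C \<ge> 0" "affine_modulus F e C f"
proof -
  obtain B where B: "\<And>t. \<bar>f t\<bar> \<le> B" using periodic_bounded[OF f] by metis
  then have "0 \<le> B" using abs_ge_zero order_trans by blast
  obtain d where d: "d > 0" "\<And>s t. \<bar>s - t\<bar> < d \<Longrightarrow> \<bar>f s - f t\<bar> < e"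
    using periodic_uniformly_continuous[OF f \<open>e > 0\<close>] by metis
  have "\<exists>u\<in>{0..1}. \<forall>s\<in>{0..1}. F (u + d) - F u \<le> F (s + d) - F s"
    by (intro continuous_attains_inf continuous_intros continuous_on_compose2[OF F(2)]) auto
  \<comment> \<open>The least growth of \<open>F\<close> over a step of length \<open>d\<close> is
    attained on a period, hence positive by strict monotonicity.\<close>
  then obtain u where u: "\<And>s. s \<in> {0..1} \<Longrightarrow> F (u + d) - F u \<le> F (s + d) - F s" by blast
  define h where "h = F (u + d) - F u"
  have "h > 0" using F(3) d(1) by (simp add: h_def strict_mono_def)
  have gap: "h \<le> F (s + d) - F s" for s
  proof -
    have "F (frac s + d) = F (s + d) + of_int (- \<lfloor>s\<rfloor>)" "F (frac s) = F s + of_int (- \<lfloor>s\<rfloor>)"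
      using degree_one_add_int[OF F(1), of "s + d" "- \<lfloor>s\<rfloor>"] degree_one_add_int[OF F(1), of s "- \<lfloor>s\<rfloor>"]
      by (simp_all add: frac_def algebra_simps)
    moreover have "frac s \<in> {0..1}" by (simp add: frac_lt_1 less_imp_le)
    ultimately show ?thesis using u[of "frac s"] by (simp add: h_def)
  qed
  have "\<bar>f t - f s\<bar> \<le> e + 2 * B / h * (F t - F s)" if "s \<le> t" for s t
  proof (cases "t - s < d")
    case True
    then have "\<bar>f t - f s\<bar> < e" using that d(2)[of t s] by simp
    moreover have "0 \<le> 2 * B / h * (F t - F s)"
      using \<open>0 \<le> B\<close> \<open>h > 0\<close> degree_one_mono[OF F(1) that] by simp
    ultimately show ?thesis by linarith
  next
    case False
    have "F (s + d) \<le> F t" using False by (intro degree_one_mono[OF F(1)]) simp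
    then have "2 * B / h * h \<le> 2 * B / h * (F t - F s)"
      using gap[of s] \<open>0 \<le> B\<close> \<open>h > 0\<close> by (intro mult_left_mono) auto
    moreover have "2 * B / h * h = 2 * B" using \<open>h > 0\<close> by simp
    moreover have "\<bar>f t - f s\<bar> \<le> 2 * B" using B[of t] B[of s] by linarith
    ultimately show ?thesis using \<open>e > 0\<close> by linarith
  qed
  then show ?thesis using that[of "2 * B / h"] \<open>0 \<le> B\<close> \<open>h > 0\<close> by (auto simp: affine_modulus_def)
qed

section \<open>The maximum principle and regularity of harmonic functions\<close>

text \<open>Density is asked of the orbit of one map, \<open>i0\<close>; its positive weight lets
  the minimality of that map act on the average.\<close>

locale transitive_walk = transitive_lift g "G i0" x
  for g and G :: "'i \<Rightarrow> real \<Rightarrow> real" and i0 x +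
  fixes I :: "'i set" and p :: "'i \<Rightarrow> real"
  assumes finite: "finite I" and p_pos: "\<And>i. i \<in> I \<Longrightarrow> 0 < p i" and p_sum: "sum p I = 1"
    and lifts: "\<And>i. i \<in> I \<Longrightarrow> circle_lift (G i)" and i0: "i0 \<in> I"
begin

abbreviation "U \<equiv> avg_op I p G"

lemma p_nonneg: "i \<in> I \<Longrightarrow> 0 \<le> p i"
  using p_pos less_imp_le by blast

text \<open>The gaps \<open>M - J (G i t)\<close> are nonnegative and their weighted sum is at most
  0, so each of them vanishes.\<close>

lemma avg_eq_upper_bound:
  assumes "\<And>t. J t \<le> M" "M \<le> U J t" "i \<in> I"
  shows "J (G i t) = M"
proof -
  have "(\<Sum>i\<in>I. p i * (M - J (G i t))) = M - U J t"
    by (simp add: avg_op_def algebra_simps sum_subtractf p_sum flip: sum_distrib_left)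
  then have "(\<Sum>i\<in>I. p i * (M - J (G i t))) = 0"
    using assms(2) sum_nonneg[of I "\<lambda>i. p i * (M - J (G i t))"] p_nonneg assms(1) by force
  then have "p i * (M - J (G i t)) = 0"
    by (subst (asm) sum_nonneg_eq_0_iff) (use finite p_nonneg assms in auto)
  then show ?thesis using p_pos[OF assms(3)] by simp
qed

text \<open>The maximum is attained at some \<open>a\<close> and propagates along the orbit of
  \<open>a\<close> under \<open>G i0\<close>. This orbit is dense modulo 1 and would meet the open
  set where \<open>J\<close> is smaller.\<close>

lemma maximum_principle:
  assumes usc: "\<And>c. open {t. J t < c}" and per: "\<And>t. J (t + 1) = J t"
    and sub: "\<And>t. J t \<le> U J t"
  obtains M where "\<And>t. J t = M"
proof -
  obtain a where a: "\<And>t. J t \<le> J a" using usc_periodic_attains_sup[OF usc per] by metis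
  have orbit: "J ((G i0 ^^ n) a) = J a" for n
  proof (induction n)
    case (Suc n)
    have "J a \<le> U J ((G i0 ^^ n) a)" using sub[of "(G i0 ^^ n) a"] Suc by simp
    then show ?case using avg_eq_upper_bound[where J=J and t="(G i0 ^^ n) a", OF a _ i0] by simp
  qed simp
  have "J t = J a" for t
  proof (rule ccontr)
    assume "J t \<noteq> J a"
    then have "t \<in> {t. J t < J a}" using a[of t] by simp
    then obtain e where e: "e > 0" "ball t e \<subseteq> {t. J t < J a}"
      using usc open_contains_ball by blast
    obtain n m where "t - e < (G i0 ^^ n) a + of_int m" "(G i0 ^^ n) a + of_int m < t + e"
      using orbit_dense[of "t - e" "t + e" a] e(1) by auto
    then have "(G i0 ^^ n) a + of_int m \<in> ball t e" by (auto simp: dist_real_def)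
    with e(2) have "J ((G i0 ^^ n) a + of_int m) < J a" by blast
    then show False using periodic_add_int[of J 0] per orbit by simp
  qed
  then show ?thesis by (rule that)
qed

text \<open>The jump of \<open>F\<close> is an upper semicontinuous, periodic, subharmonic function,
  hence constant. A positive jump at every point is impossible, as \<open>F\<close> grows by only 1
  over a period.\<close>

lemma harmonic_continuous:
  assumes F: "degree_one F" "\<And>t. U F t = F t + c"
  shows "continuous_on UNIV F"
proof -
  \<comment> \<open>\<open>J t\<close> is the oscillation of \<open>F\<close> at \<open>t\<close>,
    taken over symmetric intervals shrinking to \<open>t\<close>.\<close>
  define S where "S = (\<lambda>t. (\<lambda>d. F (t + d) - F (t - d)) ` {0<..})"
  define J where "J = (\<lambda>t. Inf (S t))"
  have S_nonneg: "0 \<le> y" if "y \<in> S t" for y t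
    using that degree_one_mono[OF F(1)] by (auto simp: S_def)
  have S_bdd: "bdd_below (S t)" for t using S_nonneg by (rule bdd_belowI)
  have S_ne: "S t \<noteq> {}" for t by (auto simp: S_def)
  have J_le: "J t \<le> F (t + d) - F (t - d)" if "d > 0" for t d
    unfolding J_def by (rule cInf_lower) (use that S_bdd in \<open>auto simp: S_def\<close>)
  have J_less: "\<exists>d>0. F (t + d) - F (t - d) < b" if "J t < b" for t b
    using that cInf_less_iff[OF S_ne S_bdd] unfolding J_def by (auto simp: S_def)
  have J_nonneg: "0 \<le> J t" for t unfolding J_def by (rule cInf_greatest[OF S_ne S_nonneg])
  have usc: "open {t. J t < b}" for b
    unfolding open_contains_ball
  proof (intro ballI)
    fix t assume "t \<in> {t. J t < b}"
    then obtain d where d: "d > 0" "F (t + d) - F (t - d) < b" using J_less by blast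
    have "J s < b" if "s \<in> ball t (d / 2)" for s
    proof -
      have "t - d \<le> s - d / 2" "s + d / 2 \<le> t + d"
        using that by (simp_all add: dist_real_def abs_less_iff) argo+
      then have "F (s + d / 2) - F (s - d / 2) \<le> F (t + d) - F (t - d)"
        by (auto intro: diff_mono[OF degree_one_mono[OF F(1)] degree_one_mono[OF F(1)]])
      with J_le[of "d / 2" s] d show ?thesis by simp
    qed
    with d(1) show "\<exists>e>0. ball t e \<subseteq> {t. J t < b}" by (intro exI[of _ "d / 2"]) auto
  qed
  have "S (t + 1) = S t" for t
  proof -
    have "F (t + 1 + d) - F (t + 1 - d) = F (t + d) - F (t - d)" for d
      using F(1) unfolding degree_one_def by (metis add.commute add.left_commute add_diff_cancel_right diff_add_eq)
    then show ?thesis by (simp add: S_def)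
  qed
  then have per: "J (t + 1) = J t" for t by (simp add: J_def)
  have sub: "J t \<le> U J t" for t
  proof (rule field_le_epsilon)
    fix e :: real assume "e > 0"
    have "\<exists>d>0. F (G i t + d) - F (G i t - d) < J (G i t) + e" for i
      using J_less \<open>e > 0\<close> by simp
    then obtain d where d: "\<And>i. d i > 0" "\<And>i. F (G i t + d i) - F (G i t - d i) < J (G i t) + e"
      by metis
    \<comment> \<open>As \<open>I\<close> is finite, a single radius \<open>h\<close> works for all
      maps: each \<open>G i\<close> carries the endpoints around \<open>t\<close> into the interval
      chosen around \<open>G i t\<close>.\<close>
    have "eventually (\<lambda>h. \<forall>i\<in>I. \<bar>G i (t + h) - G i t\<bar> < d i \<and> \<bar>G i (t - h) - G i t\<bar> < d i) (at_right 0)"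
    proof (intro eventually_ball_finite finite ballI eventually_conj)
      fix i assume "i \<in> I"
      then have c: "isCont (G i) t" using lifts by (auto simp: circle_lift_def continuous_on_eq_continuous_at)
      have "((\<lambda>h. t + h) \<longlongrightarrow> t) (at_right 0)" "((\<lambda>h. t - h) \<longlongrightarrow> t) (at_right 0)"
        by (auto intro!: tendsto_eq_intros)
      from this[THEN isCont_tendsto_compose[OF c]]
      show "eventually (\<lambda>h. \<bar>G i (t + h) - G i t\<bar> < d i) (at_right 0)"
        "eventually (\<lambda>h. \<bar>G i (t - h) - G i t\<bar> < d i) (at_right 0)"
        using d(1)[of i] by (auto simp: tendsto_iff dist_real_def)
    qed
    then have "eventually (\<lambda>h. 0 < h \<and> (\<forall>i\<in>I. \<bar>G i (t + h) - G i t\<bar> < d i \<and> \<bar>G i (t - h) - G i t\<bar> < d i)) (at_right 0)"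
      by (intro eventually_conj eventually_at_right_less)
    then obtain h where h: "0 < h"
      "\<And>i. i \<in> I \<Longrightarrow> \<bar>G i (t + h) - G i t\<bar> < d i" "\<And>i. i \<in> I \<Longrightarrow> \<bar>G i (t - h) - G i t\<bar> < d i"
      using eventually_happens'[OF trivial_limit_at_right_real] by (metis (mono_tags, lifting))
    have "J t \<le> F (t + h) - F (t - h)" by (rule J_le[OF h(1)])
    also have "\<dots> = U F (t + h) - U F (t - h)" by (simp add: F(2))
    also have "\<dots> = (\<Sum>i\<in>I. p i * (F (G i (t + h)) - F (G i (t - h))))"
      by (simp add: avg_op_def algebra_simps sum_subtractf)
    also have "\<dots> \<le> (\<Sum>i\<in>I. p i * (J (G i t) + e))"
    proof (intro sum_mono mult_left_mono p_nonneg)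
      fix i assume i: "i \<in> I"
      have "F (G i (t + h)) - F (G i (t - h)) \<le> F (G i t + d i) - F (G i t - d i)"
        using h(2,3)[OF i] by (auto intro!: diff_mono[OF degree_one_mono[OF F(1)] degree_one_mono[OF F(1)]])
      with d(2)[of i] show "F (G i (t + h)) - F (G i (t - h)) \<le> J (G i t) + e" by simp
    qed
    also have "\<dots> = U J t + e"
      using p_sum by (simp add: avg_op_def distrib_left sum.distrib flip: sum_distrib_right)
    finally show "J t \<le> U J t + e" .
  qed
  obtain M where M: "\<And>t. J t = M" using maximum_principle[OF usc per sub] by metis
  \<comment> \<open>Cut the unit interval into \<open>n\<close> pieces; over each piece
    \<open>F\<close> grows by at least the jump \<open>M\<close> at its midpoint.\<close>
  have "real n * M \<le> 1" for n
  proof (cases "n = 0")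
    case False
    have "M \<le> F (real (Suc j) / real n) - F (real j / real n)" for j
    proof -
      have "(real j + 1 / 2) / real n + 1 / (2 * real n) = real (Suc j) / real n"
        "(real j + 1 / 2) / real n - 1 / (2 * real n) = real j / real n"
        using False by (simp_all add: field_simps)
      with J_le[of "1 / (2 * real n)" "(real j + 1 / 2) / real n"] False show ?thesis by (simp add: M)
    qed
    then have "(\<Sum>j<n. M) \<le> (\<Sum>j<n. F (real (Suc j) / real n) - F (real j / real n))"
      by (intro sum_mono)
    also have "\<dots> = F 1 - F 0"
      using False unfolding sum_lessThan_telescope[of "\<lambda>j. F (real j / real n)"] by simp
    also have "\<dots> = 1" using degree_one_add_int[OF F(1), of 0 1] by simp
    finally show ?thesis by simp
  qed simp
  have "M \<le> 0"
  proof (rule ccontr)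
    assume "\<not> M \<le> 0"
    then obtain n where "1 < real n * M" using reals_Archimedean3[of M] by auto
    with \<open>real n * M \<le> 1\<close> show False by simp
  qed
  show ?thesis
    unfolding continuous_on_eq_continuous_at[OF open_UNIV]
  proof (intro ballI)
    fix t
    show "isCont F t"
      unfolding continuous_at_eps_delta
    proof (intro allI impI)
      fix e :: real assume "e > 0"
      then have "J t < e" using M[of t] \<open>M \<le> 0\<close> by simp
      then obtain d where d: "d > 0" "F (t + d) - F (t - d) < e" using J_less by blast
      have "\<bar>F s - F t\<bar> < e" if "\<bar>s - t\<bar> < d" for s
      proof -
        have "t - d \<le> s" "s \<le> t + d" "t - d \<le> t" "t \<le> t + d" using that d(1) by auto
        from this[THEN degree_one_mono[OF F(1)]] d(2) show ?thesis by auto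
      qed
      with d(1) show "\<exists>d>0. \<forall>s. dist s t < d \<longrightarrow> dist (F s) (F t) < e"
        by (auto simp: dist_real_def)
    qed
  qed
qed

text \<open>By harmonicity and positivity of the weights, \<open>G i0\<close> maps a flat interval
  to a flat interval. Its iterates reach every point modulo 1, so \<open>F\<close> would be locally
  constant, hence constant.\<close>

lemma harmonic_strict_mono:
  assumes F: "degree_one F" "\<And>t. U F t = F t + c"
  shows "strict_mono F"
proof (rule ccontr)
  assume "\<not> strict_mono F"
  then obtain s t where st: "s < t" "F s = F t"
    using degree_one_mono[OF F(1)] unfolding strict_mono_def by (meson less_eq_real_def not_less)
  have step: "F (G i0 a) = F (G i0 b)" if "a \<le> b" "F a = F b" for a b
  proof -
    have "(\<Sum>i\<in>I. p i * (F (G i b) - F (G i a))) = U F b - U F a"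
      by (simp add: avg_op_def algebra_simps sum_subtractf)
    then have "(\<Sum>i\<in>I. p i * (F (G i b) - F (G i a))) = 0" using that F(2) by simp
    moreover have "0 \<le> p i * (F (G i b) - F (G i a))" if "i \<in> I" for i
      using p_nonneg[OF that] degree_one_mono[OF F(1)] \<open>a \<le> b\<close>
        degree_one_mono[OF circle_lift_degree_one[OF lifts[OF that]]] by simp
    ultimately have "p i0 * (F (G i0 b) - F (G i0 a)) = 0"
      using sum_nonneg_eq_0_iff[OF finite] i0 by (metis (mono_tags, lifting))
    then show ?thesis using p_pos[OF i0] by simp
  qed
  have flat: "F ((G i0 ^^ n) s) = F ((G i0 ^^ n) t)" for n
  proof (induction n)
    case (Suc n)
    have "(G i0 ^^ n) s \<le> (G i0 ^^ n) t"
      using degree_one_mono[OF circle_lift_degree_one[OF circle_lift_funpow[OF lift]]] st by simp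
    then show ?case using step Suc by simp
  qed (use st in simp)
  have "(F has_real_derivative 0) (at z)" for z
  proof -
    obtain n m where nm: "(G i0 ^^ n) s < z + of_int m" "z + of_int m < (G i0 ^^ n) t"
      using image_covers[OF st(1)] by metis
    define A where "A = {(G i0 ^^ n) s - of_int m<..<(G i0 ^^ n) t - of_int m}"
    have "F w = F ((G i0 ^^ n) s) - of_int m" if "w \<in> A" for w
      using that degree_one_mono[OF F(1), of "(G i0 ^^ n) s" "w + of_int m"]
        degree_one_mono[OF F(1), of "w + of_int m" "(G i0 ^^ n) t"] flat[of n]
        degree_one_add_int[OF F(1), of w m] by (simp add: A_def)
    moreover have "open A" "z \<in> A" using nm by (auto simp: A_def)
    ultimately show ?thesis
      by (intro has_field_derivative_transform_within_open[OF DERIV_const, of A z "F ((G i0 ^^ n) s) - of_int m" F])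
        simp_all
  qed
  then have "F 1 = F 0" using DERIV_isconst_all by blast
  then show False using degree_one_add_int[OF F(1), of 0 1] by simp
qed

section \<open>Equicontinuity and the limit of the Cesaro means\<close>

lemma affine_modulus_U:
  assumes F: "degree_one F" "\<And>t. U F t = F t + c" and f: "affine_modulus F e C f"
  shows "affine_modulus F e C (U f)"
  unfolding affine_modulus_def
proof (intro allI impI)
  fix s t :: real assume "s \<le> t"
  have "\<bar>U f t - U f s\<bar> = \<bar>\<Sum>i\<in>I. p i * (f (G i t) - f (G i s))\<bar>"
    by (simp add: avg_op_def algebra_simps sum_subtractf)
  also have "\<dots> \<le> (\<Sum>i\<in>I. p i * (e + C * (F (G i t) - F (G i s))))"
  proof (intro order_trans[OF sum_abs] sum_mono)
    fix i assume i: "i \<in> I"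
    have "G i s \<le> G i t"
      using degree_one_mono[OF circle_lift_degree_one[OF lifts[OF i]] \<open>s \<le> t\<close>] .
    then show "\<bar>p i * (f (G i t) - f (G i s))\<bar> \<le> p i * (e + C * (F (G i t) - F (G i s)))"
      using f p_nonneg[OF i] by (simp add: abs_mult affine_modulus_def mult_left_mono)
  qed
  also have "\<dots> = sum p I * e + C * (U F t - U F s)"
    unfolding avg_op_def
    by (simp add: sum_distrib_right sum_distrib_left sum.distrib sum_subtractf algebra_simps)
  finally show "\<bar>U f t - U f s\<bar> \<le> e + C * (F t - F s)" by (simp add: F(2) p_sum)
qed

lemma affine_modulus_cesaro:
  assumes F: "degree_one F" "\<And>t. U F t = F t + c" and f: "affine_modulus F e C f" and "n \<ge> 1"
  shows "affine_modulus F e C (cesaro I p G n f)"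
  unfolding affine_modulus_def
proof (intro allI impI)
  fix s t :: real assume "s \<le> t"
  have "affine_modulus F e C ((U ^^ j) f)" for j
    by (induction j) (simp_all add: f affine_modulus_U[OF F])
  then have "\<bar>\<Sum>j<n. (U ^^ j) f t - (U ^^ j) f s\<bar> \<le> (\<Sum>j<n. e + C * (F t - F s))"
    using \<open>s \<le> t\<close> by (intro order_trans[OF sum_abs] sum_mono) (simp add: affine_modulus_def)
  then show "\<bar>cesaro I p G n f t - cesaro I p G n f s\<bar> \<le> e + C * (F t - F s)"
    using \<open>n \<ge> 1\<close>
    by (simp add: cesaro_def sum_subtractf abs_divide flip: diff_divide_distrib) (simp add: field_simps)
qed

text \<open>A cluster point of the Cesaro means is continuous and invariant, hence a constant
  \<open>c\<close>. The common affine modulus turns closeness to \<open>c\<close> on a finite grid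
  into uniform closeness for one \<open>n\<close>.\<close>

proposition cesaro_nearly_constant:
  assumes f: "continuous_on UNIV f" "\<And>t. f (t + 1) = f t" and "e > 0"
  obtains n c where "n \<ge> 1" "\<And>t. \<bar>cesaro I p G n f t - c\<bar> \<le> e"
proof -
  let ?A = "\<lambda>n. cesaro I p G n f"
  obtain F c0 where F: "degree_one F" "\<And>t. U F t = F t + c0"
    using exists_harmonic_degree_one[of I p G] p_nonneg p_sum circle_lift_degree_one[OF lifts] by metis
  note Fc = harmonic_continuous[OF F] and Fs = harmonic_strict_mono[OF F]
  obtain B where B: "\<And>t. \<bar>f t\<bar> \<le> B" using periodic_bounded[OF f] by metis
  then have "0 \<le> B" using abs_ge_zero order_trans by blast
  have Uj_bound: "\<bar>(U ^^ j) f t\<bar> \<le> B" for j t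
  proof (induction j arbitrary: t)
    case (Suc j) then show ?case by (simp add: avg_op_abs_le p_nonneg p_sum)
  qed (simp add: B)
  have Uj_per: "(U ^^ j) f (t + 1) = (U ^^ j) f t" for j t
  proof (induction j arbitrary: t)
    case (Suc j)
    have "(U ^^ j) f (G i (t + 1)) = (U ^^ j) f (G i t)" if "i \<in> I" for i
      using Suc lifts[OF that] by (simp add: circle_lift_def)
    then show ?case by (simp add: avg_op_def[where f="(U ^^ j) f"])
  qed (simp add: f)
  have A_per: "?A n (t + 1) = ?A n t" for n t by (simp add: cesaro_def Uj_per)
  have "\<bar>?A n t\<bar> \<le> B" for n t
  proof (cases "n = 0")
    case False
    have "\<bar>\<Sum>j<n. (U ^^ j) f t\<bar> \<le> (\<Sum>j<n. B)"
      by (intro order_trans[OF sum_abs] sum_mono Uj_bound)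
    then show ?thesis using False by (simp add: cesaro_def field_simps)
  qed (simp add: cesaro_def \<open>0 \<le> B\<close>)
  from pointwise_cluster_point[of ?A, OF this]
  obtain L l where L: "L \<noteq> bot" "L \<le> sequentially" and l: "\<And>t. ((\<lambda>n. ?A n t) \<longlongrightarrow> l t) L"
    by metis
  have ev1: "eventually (\<lambda>n. n \<ge> 1) L" using filter_leD[OF L(2) eventually_ge_at_top] .
  have l_modulus: "affine_modulus F e' C l" if "affine_modulus F e' C f" for e' C
    unfolding affine_modulus_def
  proof (intro allI impI)
    fix s t :: real assume "s \<le> t"
    show "\<bar>l t - l s\<bar> \<le> e' + C * (F t - F s)"
    proof (rule tendsto_upperbound[OF _ _ L(1)])
      show "((\<lambda>n. \<bar>?A n t - ?A n s\<bar>) \<longlongrightarrow> \<bar>l t - l s\<bar>) L" by (intro tendsto_intros l)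
      show "eventually (\<lambda>n. \<bar>?A n t - ?A n s\<bar> \<le> e' + C * (F t - F s)) L"
        by (rule eventually_mono[OF ev1])
          (use affine_modulus_cesaro[OF F that] \<open>s \<le> t\<close> in \<open>simp add: affine_modulus_def\<close>)
    qed
  qed
  \<comment> \<open>Half of \<open>e'\<close> is the fixed part of the modulus, the other half comes
    from continuity of \<open>F\<close>; \<open>C + 1\<close> in the denominator guards against
    \<open>C = 0\<close>.\<close>
  have l_cont: "isCont l t" for t
    unfolding continuous_at_eps_delta
  proof (intro allI impI)
    fix e' :: real assume "e' > 0"
    then obtain C where C: "C \<ge> 0" "affine_modulus F (e' / 2) C f"
      using exists_affine_modulus[OF F(1) Fc Fs f, of "e' / 2"] by auto
    have lC: "\<bar>l t - l s\<bar> \<le> e' / 2 + C * \<bar>F t - F s\<bar>" for s t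
    proof (cases "s \<le> t")
      case True
      then show ?thesis using l_modulus[OF C(2)] degree_one_mono[OF F(1) True]
        by (simp add: affine_modulus_def)
    next
      case False
      then have "\<bar>l s - l t\<bar> \<le> e' / 2 + C * (F s - F t)"
        using l_modulus[OF C(2)] by (simp add: affine_modulus_def)
      then show ?thesis using degree_one_mono[OF F(1), of t s] False by (simp add: abs_minus_commute)
    qed
    have "isCont F t" using Fc by (simp add: continuous_on_eq_continuous_at)
    then obtain d where d: "d > 0" "\<And>s. \<bar>s - t\<bar> < d \<Longrightarrow> \<bar>F s - F t\<bar> < e' / (2 * (C + 1))"
      unfolding continuous_at_eps_delta dist_real_def using \<open>e' > 0\<close> C(1)
      by (metis add_nonneg_pos divide_pos_pos mult_pos_pos zero_less_numeral zero_less_one)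
    have "\<bar>l s - l t\<bar> < e'" if "\<bar>s - t\<bar> < d" for s
    proof -
      have "C * \<bar>F s - F t\<bar> \<le> C * (e' / (2 * (C + 1)))"
        using d(2)[OF that] C(1) by (intro mult_left_mono) auto
      also have "\<dots> < e' / 2" using C(1) \<open>e' > 0\<close> by (simp add: field_simps)
      finally show ?thesis using lC[of s t] by linarith
    qed
    with d(1) show "\<exists>d>0. \<forall>s. dist s t < d \<longrightarrow> dist (l s) (l t) < e'"
      by (auto simp: dist_real_def)
  qed
  have l_per: "l (t + 1) = l t" for t
    using tendsto_unique[OF L(1) l[of "t + 1"]] l[of t] by (simp add: A_per)
  \<comment> \<open>The average is a finite sum and passes to the limit; by telescoping the defect
    is at most \<open>2 * B / n\<close>.\<close>
  have "U l t - l t = 0" for t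
  proof (rule tendsto_unique[OF L(1)])
    show "((\<lambda>n. U (?A n) t - ?A n t) \<longlongrightarrow> U l t - l t) L" by (intro tendsto_intros avg_op_tendsto l)
    have "(\<lambda>n. ((U ^^ n) f t - f t) / real n) \<longlonglongrightarrow> 0"
    proof (rule Lim_null_comparison)
      have "norm (((U ^^ n) f t - f t) / real n) \<le> 2 * B / real n" for n
        using Uj_bound[of n t] B[of t] by (auto simp: abs_divide intro!: divide_right_mono)
      then show "eventually (\<lambda>n. norm (((U ^^ n) f t - f t) / real n) \<le> 2 * B / real n) sequentially"
        by simp
      show "(\<lambda>n. 2 * B / real n) \<longlonglongrightarrow> 0" by real_asymp
    qed
    then show "((\<lambda>n. U (?A n) t - ?A n t) \<longlongrightarrow> 0) L"
      unfolding avg_op_cesaro by (rule tendsto_mono[OF L(2)])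
  qed
  then have "l t \<le> U l t" for t by simp
  moreover have "open {t. l t < b}" for b
    by (intro open_Collect_less continuous_on_const) (simp add: continuous_on_eq_continuous_at l_cont)
  ultimately obtain c where c: "\<And>t. l t = c" using maximum_principle[of l] l_per by metis
  \<comment> \<open>The error \<open>e\<close> is split in three: the fixed part of the modulus, the
    growth of \<open>F\<close> within one grid cell times \<open>C\<close>, and the error at the
    grid point.\<close>
  obtain C where C: "C \<ge> 0" "affine_modulus F (e / 3) C f"
    using exists_affine_modulus[OF F(1) Fc Fs f, of "e / 3"] \<open>e > 0\<close> by auto
  have "uniformly_continuous_on {0..1} F"
    by (rule compact_uniformly_continuous) (auto intro: continuous_on_subset[OF Fc])
  moreover have "0 < e / (3 * (C + 1))" using \<open>e > 0\<close> C(1) by simp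
  ultimately obtain d where d: "d > 0"
    "\<And>s t. s \<in> {0..1} \<Longrightarrow> t \<in> {0..1} \<Longrightarrow> dist s t < d \<Longrightarrow> dist (F s) (F t) < e / (3 * (C + 1))"
    unfolding uniformly_continuous_on_def by metis
  obtain N :: nat where N: "N > 0" "1 / real N < d"
    using d(1) by (metis nat_approx_posE zero_less_Suc)
  \<comment> \<open>Only finitely many grid points are involved, so pointwise convergence along
    \<open>L\<close> yields one \<open>n\<close> that serves them all.\<close>
  have "eventually (\<lambda>n. \<forall>j\<in>{..N}. dist (?A n (real j / real N)) c < e / 3) L"
    using \<open>e > 0\<close> by (intro eventually_ball_finite ballI tendstoD) (use l[unfolded c] in auto)
  from eventually_happens'[OF L(1) eventually_conj[OF ev1 this]]
  obtain n where n: "n \<ge> 1" "\<And>j. j \<le> N \<Longrightarrow> \<bar>?A n (real j / real N) - c\<bar> < e / 3"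
    by (auto simp: dist_real_def)
  have "\<bar>?A n t - c\<bar> \<le> e" for t
  proof -
    define s where "s = frac t"
    have s: "0 \<le> s" "s < 1" by (simp_all add: s_def frac_lt_1)
    define j where "j = nat \<lfloor>s * real N\<rfloor>"
    have j: "real j \<le> s * real N" "s * real N < real j + 1"
      using s N(1) by (auto simp: j_def)
    moreover have "s * real N < 1 * real N" using s(2) N(1) by (intro mult_strict_right_mono) auto
    ultimately have "j \<le> N" by simp
    have j': "real j / real N \<le> s" "s < (real j + 1) / real N"
      using j N(1) by (simp_all add: field_simps)
    then have "s - real j / real N < 1 / real N" by (simp add: add_divide_distrib)
    note j' = j'(1) this
    have "dist s (real j / real N) < d" using j' N(2) by (simp add: dist_real_def)
    then have "F s - F (real j / real N) < e / (3 * (C + 1))"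
      using d(2)[of s "real j / real N"] s \<open>j \<le> N\<close> N(1) by (simp add: dist_real_def)
    then have "C * (F s - F (real j / real N)) \<le> C * (e / (3 * (C + 1)))"
      using C(1) by (intro mult_left_mono) auto
    also have "\<dots> \<le> e / 3" using C(1) \<open>e > 0\<close> by (simp add: field_simps)
    finally have "\<bar>?A n s - ?A n (real j / real N)\<bar> \<le> e / 3 + e / 3"
      using affine_modulus_cesaro[OF F C(2) n(1)] j'(1) by (force simp: affine_modulus_def)
    then have "\<bar>?A n s - c\<bar> \<le> e" using n(2)[OF \<open>j \<le> N\<close>] by linarith
    moreover have "?A n s = ?A n t"
      using periodic_add_int[of "?A n" 0 t "- \<lfloor>t\<rfloor>"] A_per by (simp add: s_def frac_def)
    ultimately show ?thesis by simp
  qed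
  then show ?thesis using that n(1) by blast
qed

end

section \<open>The martingale of a random orbit\<close>

text \<open>For negative \<open>y\<close> put \<open>z = - y\<close>: the product of
  \<open>1 - z + z^2\<close> with the Taylor minorant \<open>1 + z + z^2/2\<close> of
  \<open>exp z\<close> has no linear term and is at least 1.\<close>

lemma exp_le_quadratic:
  fixes y :: real
  assumes "\<bar>y\<bar> \<le> 1"
  shows "exp y \<le> 1 + y + y\<^sup>2"
proof (cases "0 \<le> y")
  case True then show ?thesis using exp_bound assms by simp
next
  case False
  define z where "z = - y"
  have z: "0 \<le> z" using False by (simp add: z_def)
  have "1 \<le> 1 + z\<^sup>2 / 2 + z ^ 3 / 2 + z ^ 4 / 2" using z by simp
  also have "\<dots> = (1 - z + z\<^sup>2) * (1 + z + z\<^sup>2 / 2)"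
    by (simp add: power2_eq_square power3_eq_cube power4_eq_xxxx field_simps)
  also have "\<dots> \<le> (1 - z + z\<^sup>2) * exp z"
  proof (rule mult_left_mono)
    show "1 + z + z\<^sup>2 / 2 \<le> exp z" by (rule exp_lower_Taylor_quadratic[OF z])
    show "0 \<le> 1 - z + z\<^sup>2" using assms False by (simp add: z_def)
  qed
  finally have "1 / exp z \<le> 1 - z + z\<^sup>2" by (simp add: field_simps)
  then show ?thesis by (simp add: z_def exp_minus field_simps)
qed

lemma space_borel_S1: "space borel_S1 = S1"
  by (simp add: borel_S1_def space_restrict_space)

lemma measurable_S1: "continuous_on S1 f \<Longrightarrow> (f :: complex \<Rightarrow> real) \<in> borel_measurable borel_S1"
  unfolding borel_S1_def by (rule borel_measurable_continuous_on_restrict)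

lemma bounded_on_S1:
  assumes "continuous_on S1 (f :: complex \<Rightarrow> real)"
  obtains B where "\<And>y. y \<in> S1 \<Longrightarrow> \<bar>f y\<bar> \<le> B"
proof -
  have "bounded (f ` S1)"
    by (intro compact_imp_bounded compact_continuous_image assms) simp
  then obtain B where "\<forall>y\<in>f ` S1. norm y \<le> B" unfolding bounded_iff by (rule exE)
  then show ?thesis using that[of B] by (simp del: mem_sphere)
qed

section \<open>The path measure and random orbits\<close>

locale circle_walk =
  fixes k :: nat and g :: "nat \<Rightarrow> complex \<Rightarrow> complex" and p :: "nat \<Rightarrow> real"
  assumes g_cont: "\<And>i. i \<in> {1..k} \<Longrightarrow> continuous_on S1 (g i)"
    and g_S1: "\<And>i y. i \<in> {1..k} \<Longrightarrow> y \<in> S1 \<Longrightarrow> g i y \<in> S1"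
    and p_nonneg: "\<And>i. i \<in> {1..k} \<Longrightarrow> 0 \<le> p i"
    and p_sum: "sum p {1..k} = 1"
begin

abbreviation "U \<equiv> avg_op {1..k} p g"

lemma prob_index_dist: "prob_space (index_dist k p)"
proof -
  have "(\<Sum>i\<in>{1..k}. ennreal (p i)) = 1"
    using sum_ennreal[of "{1..k}" p] p_nonneg p_sum by simp
  then show ?thesis unfolding index_dist_def by (intro prob_space_point_measure) auto
qed

text \<open>Supplies \<open>PiM_iter\<close>: prepending an independent index preserves the law of
  the index sequence.\<close>

sublocale path: sequence_space "index_dist k p"
  by (simp add: sequence_space_def product_prob_space_def product_sigma_finite_def
      product_prob_space_axioms_def prob_index_dist prob_space_imp_sigma_finite)

sublocale paths: prob_space "path_measure k p"
  unfolding path_measure_def by (rule path.prob_space_axioms)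

lemma space_index_dist: "space (index_dist k p) = {1..k}"
  by (simp add: index_dist_def space_point_measure)

lemma sets_index_dist: "sets (index_dist k p) = sets (count_space {1..k})"
  by (simp add: index_dist_def sets_point_measure)

lemma path_in: "\<omega> \<in> space (path_measure k p) \<Longrightarrow> \<omega> n \<in> {1..k}"
  unfolding path_measure_def space_PiM space_index_dist by (auto simp: PiE_iff)

lemma measurable_coord: "(\<lambda>\<omega>. \<omega> n) \<in> path_measure k p \<rightarrow>\<^sub>M count_space {1..k}"
  using measurable_component_singleton[of n UNIV "\<lambda>_. index_dist k p"]
  by (simp add: path_measure_def measurable_cong_sets[OF refl sets_index_dist])

lemma measurable_g: "i \<in> {1..k} \<Longrightarrow> g i \<in> borel_S1 \<rightarrow>\<^sub>M borel_S1"
  unfolding borel_S1_def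
  by (intro measurable_restrict_space2 borel_measurable_continuous_on_restrict g_cont)
    (auto simp: space_restrict_space intro: g_S1)

lemma word_comp_S1:
  assumes "\<And>n. \<omega> n \<in> {1..k}" "x \<in> S1"
  shows "word_comp g \<omega> n x \<in> S1"
proof (induction n)
  case (Suc n) then show ?case using g_S1[OF assms(1)] by (simp del: mem_sphere)
qed (use assms(2) in simp)

lemma measurable_word_comp:
  assumes "x \<in> S1"
  shows "(\<lambda>\<omega>. word_comp g \<omega> n x) \<in> path_measure k p \<rightarrow>\<^sub>M borel_S1"
proof (induction n)
  case 0 then show ?case using assms by (simp add: space_borel_S1)
next
  case (Suc n)
  have "(\<lambda>\<omega>. g (\<omega> n) (word_comp g \<omega> n x)) \<in> path_measure k p \<rightarrow>\<^sub>M borel_S1"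
    \<comment> \<open>The random map takes countably many values, so measurability can be checked
      for each fixed index.\<close>
    by (rule measurable_compose_countable'[OF _ measurable_coord, where f="\<lambda>i \<omega>. g i (word_comp g \<omega> n x)"])
      (auto intro: measurable_compose[OF Suc measurable_g])
  then show ?case by simp
qed

lemma word_comp_case_nat: "word_comp g (case_nat i \<omega>) (Suc n) x = word_comp g \<omega> n (g i x)"
  by (induction n) simp_all

lemma continuous_on_U: "continuous_on S1 f \<Longrightarrow> continuous_on S1 (U f)"
  unfolding avg_op_def
  by (intro continuous_on_sum continuous_on_mult continuous_on_const continuous_on_compose2[of S1 f S1 "g _"] g_cont)
    (auto simp del: mem_sphere intro: g_S1)

section \<open>Exponential moments and the strong law for the martingale\<close>

text \<open>\<open>U f\<close> at the current position is the conditional expectation of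
  \<open>f\<close> at the next one, so the summands are martingale differences.\<close>

definition mart :: "(complex \<Rightarrow> real) \<Rightarrow> complex \<Rightarrow> nat \<Rightarrow> (nat \<Rightarrow> nat) \<Rightarrow> real" where
  "mart f x n \<omega> = (\<Sum>j<n. f (word_comp g \<omega> (Suc j) x) - U f (word_comp g \<omega> j x))"

lemma measurable_mart:
  assumes "continuous_on S1 f" "x \<in> S1"
  shows "mart f x n \<in> borel_measurable (path_measure k p)"
  unfolding mart_def
  by (intro borel_measurable_sum borel_measurable_diff
      measurable_compose[OF measurable_word_comp[OF assms(2)]] measurable_S1 assms continuous_on_U)

lemma mart_case_nat:
  "mart f x (Suc n) (case_nat i \<omega>) = (f (g i x) - U f x) + mart f (g i x) n \<omega>"
proof -
  have "mart f x (Suc n) (case_nat i \<omega>) = (f (g i x) - U f x) +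
    (\<Sum>j<n. f (word_comp g (case_nat i \<omega>) (Suc (Suc j)) x) - U f (word_comp g (case_nat i \<omega>) (Suc j) x))"
    unfolding mart_def by (subst sum.lessThan_Suc_shift) simp
  then show ?thesis unfolding word_comp_case_nat by (simp add: mart_def)
qed

text \<open>Conditioning on the first index: the path law is the image of a product measure under
  \<open>case_nat\<close>, and Tonelli applies.\<close>

lemma nn_integral_path:
  fixes h :: "(nat \<Rightarrow> nat) \<Rightarrow> ennreal"
  assumes "h \<in> borel_measurable (path_measure k p)"
  shows "(\<integral>\<^sup>+\<omega>. h \<omega> \<partial>path_measure k p)
    = (\<Sum>i\<in>{1..k}. ennreal (p i) * (\<integral>\<^sup>+\<omega>. h (case_nat i \<omega>) \<partial>path_measure k p))"
proof -
  note [measurable] = assms[unfolded path_measure_def]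
  have "(\<integral>\<^sup>+\<omega>. h \<omega> \<partial>path.S) =
      (\<integral>\<^sup>+\<omega>. h \<omega> \<partial>distr (index_dist k p \<Otimes>\<^sub>M path.S) path.S (\<lambda>(i, \<omega>). case_nat i \<omega>))"
    unfolding path.PiM_iter ..
  also have "\<dots> = (\<integral>\<^sup>+z. h (case_nat (fst z) (snd z)) \<partial>(index_dist k p \<Otimes>\<^sub>M path.S))"
    by (subst nn_integral_distr) (simp_all add: case_prod_beta)
  also have "\<dots> = (\<integral>\<^sup>+i. \<integral>\<^sup>+\<omega>. h (case_nat i \<omega>) \<partial>path.S \<partial>index_dist k p)"
    by (subst path.P.nn_integral_fst[symmetric]) simp_all
  also have "\<dots> = (\<Sum>i\<in>{1..k}. ennreal (p i) * (\<integral>\<^sup>+\<omega>. h (case_nat i \<omega>) \<partial>path.S))"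
    unfolding index_dist_def by (subst nn_integral_point_measure_finite) (auto simp: mult.commute)
  finally show ?thesis unfolding path_measure_def .
qed

text \<open>The first step is split off, so that only the starting point changes.\<close>

lemma nn_integral_exp_mart:
  assumes f: "continuous_on S1 f" and B: "\<And>y. y \<in> S1 \<Longrightarrow> \<bar>f y\<bar> \<le> B / 2" and l: "\<bar>l\<bar> * B \<le> 1" and "x \<in> S1"
  shows "(\<integral>\<^sup>+\<omega>. ennreal (exp (l * mart f x n \<omega>)) \<partial>path_measure k p) \<le> ennreal (exp (real n * (l * B)\<^sup>2))"
  using \<open>x \<in> S1\<close>
proof (induction n arbitrary: x)
  case 0
  then show ?case by (simp add: mart_def paths.emeasure_space_1)
next
  case (Suc n)
  let ?P = "path_measure k p" and ?E = "ennreal (exp (real n * (l * B)\<^sup>2))"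
  define d where "d = (\<lambda>i. f (g i x) - U f x)"
  \<comment> \<open>The bound \<open>B / 2\<close> for \<open>f\<close> passes to its average
    \<open>U f\<close>, so the increments \<open>d i\<close> are bounded by
    \<open>B\<close>.\<close>
  have U_le: "\<bar>U f x\<bar> \<le> B / 2"
    using p_nonneg p_sum B g_S1 Suc.prems by (intro avg_op_abs_le) (auto simp del: mem_sphere)
  have d_le: "\<bar>d i\<bar> \<le> B" if "i \<in> {1..k}" for i
    using B[OF g_S1[OF that Suc.prems]] U_le by (simp add: d_def)
  have d_mean: "(\<Sum>i\<in>{1..k}. p i * d i) = 0"
  proof -
    have "(\<Sum>i\<in>{1..k}. p i * d i) = U f x - sum p {1..k} * U f x"
      unfolding d_def right_diff_distrib sum_subtractf sum_distrib_right by (simp add: avg_op_def)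
    then show ?thesis unfolding p_sum by simp
  qed
  have [measurable]: "(\<lambda>\<omega>. ennreal (exp (l * mart f x (Suc n) \<omega>))) \<in> borel_measurable ?P"
    using measurable_mart[OF f Suc.prems] by measurable
  have "(\<integral>\<^sup>+\<omega>. ennreal (exp (l * mart f x (Suc n) \<omega>)) \<partial>?P)
      = (\<Sum>i\<in>{1..k}. ennreal (p i) * (\<integral>\<^sup>+\<omega>. ennreal (exp (l * mart f x (Suc n) (case_nat i \<omega>))) \<partial>?P))"
    by (rule nn_integral_path) measurable
  also have "\<dots> \<le> (\<Sum>i\<in>{1..k}. ennreal (p i * exp (l * d i)) * ?E)"
  proof (rule sum_mono)
    fix i assume i: "i \<in> {1..k}"
    have gx: "g i x \<in> S1" using g_S1[OF i Suc.prems] .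
    have "(\<integral>\<^sup>+\<omega>. ennreal (exp (l * mart f x (Suc n) (case_nat i \<omega>))) \<partial>?P)
        = (\<integral>\<^sup>+\<omega>. ennreal (exp (l * d i)) * ennreal (exp (l * mart f (g i x) n \<omega>)) \<partial>?P)"
      by (simp add: mart_case_nat d_def distrib_left exp_add ennreal_mult)
    also have "\<dots> = ennreal (exp (l * d i)) * (\<integral>\<^sup>+\<omega>. ennreal (exp (l * mart f (g i x) n \<omega>)) \<partial>?P)"
      using measurable_mart[OF f gx] by (intro nn_integral_cmult) measurable
    also have "\<dots> \<le> ennreal (exp (l * d i)) * ?E"
      by (intro mult_left_mono Suc.IH gx) simp
    finally show "ennreal (p i) * (\<integral>\<^sup>+\<omega>. ennreal (exp (l * mart f x (Suc n) (case_nat i \<omega>))) \<partial>?P)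
        \<le> ennreal (p i * exp (l * d i)) * ?E"
      using p_nonneg[OF i] by (simp add: ennreal_mult mult.assoc mult_left_mono)
  qed
  also have "\<dots> = ennreal (\<Sum>i\<in>{1..k}. p i * exp (l * d i)) * ?E"
    using p_nonneg by (subst sum_ennreal[symmetric]) (auto simp: sum_distrib_right)
  also have "\<dots> \<le> ennreal (exp ((l * B)\<^sup>2)) * ?E"
  proof (intro mult_right_mono ennreal_leI)
    \<comment> \<open>In the quadratic bound for \<open>exp\<close> the linear term disappears
      because the increment has mean 0.\<close>
    have "(\<Sum>i\<in>{1..k}. p i * exp (l * d i)) \<le> (\<Sum>i\<in>{1..k}. p i * (1 + l * d i + (l * B)\<^sup>2))"
    proof (intro sum_mono mult_left_mono p_nonneg)
      fix i assume i: "i \<in> {1..k}"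
      have ld: "\<bar>l * d i\<bar> \<le> \<bar>l\<bar> * B" using d_le[OF i] by (simp add: abs_mult mult_left_mono)
      then have "(l * d i)\<^sup>2 \<le> (l * B)\<^sup>2"
        using power_mono[of "\<bar>l * d i\<bar>" "\<bar>l\<bar> * B" 2] by (simp add: power_mult_distrib)
      with exp_le_quadratic[of "l * d i"] ld l show "exp (l * d i) \<le> 1 + l * d i + (l * B)\<^sup>2" by linarith
    qed
    also have "\<dots> = sum p {1..k} + l * (\<Sum>i\<in>{1..k}. p i * d i) + sum p {1..k} * (l * B)\<^sup>2"
      by (simp add: distrib_left sum.distrib sum_distrib_left sum_distrib_right mult_ac)
    also have "\<dots> = 1 + (l * B)\<^sup>2" unfolding d_mean p_sum by simp
    also have "\<dots> \<le> exp ((l * B)\<^sup>2)" by (rule exp_ge_add_one_self)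
    finally show "(\<Sum>i\<in>{1..k}. p i * exp (l * d i)) \<le> exp ((l * B)\<^sup>2)" .
  qed simp
  also have "\<dots> = ennreal (exp (real (Suc n) * (l * B)\<^sup>2))"
    by (simp add: distrib_right exp_add flip: ennreal_mult)
  finally show ?case .
qed

lemma mart_minus: "mart (\<lambda>y. - f y) x n \<omega> = - mart f x n \<omega>"
proof -
  have "U (\<lambda>y. - f y) y = - U f y" for y by (simp add: avg_op_def sum_negf)
  then show ?thesis by (simp add: mart_def sum_negf[symmetric])
qed

text \<open>Markov's inequality for the exponential moment gives geometrically small probabilities,
  and the Borel-Cantelli lemma applies.\<close>

lemma AE_mart_less:
  assumes f: "continuous_on S1 f" and x: "x \<in> S1" and e: "0 < e" "e \<le> 1"
  shows "AE \<omega> in path_measure k p. eventually (\<lambda>n. mart f x n \<omega> < e * real n) sequentially"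
proof -
  let ?P = "path_measure k p"
  obtain B0 where B0: "\<And>y. y \<in> S1 \<Longrightarrow> \<bar>f y\<bar> \<le> B0" using bounded_on_S1[OF f] by metis
  \<comment> \<open>The maximum with 1 keeps \<open>B\<close> positive and, with \<open>e\<close> at
    most 1, ensures \<open>l * B \<le> 1\<close> below.\<close>
  define B where "B = 2 * max 1 B0"
  have B: "\<bar>f y\<bar> \<le> B / 2" if "y \<in> S1" for y using B0[OF that] by (simp add: B_def le_max_iff_disj)
  have "B \<ge> 2" by (simp add: B_def)
  \<comment> \<open>The minimiser of the exponent \<open>l^2 * B^2 - l * e\<close>, whose minimum is
    \<open>- c\<close>.\<close>
  define l where "l = e / (2 * B\<^sup>2)"
  have "l > 0" using e \<open>B \<ge> 2\<close> by (simp add: l_def)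
  have "l * B = e / (2 * B)" using \<open>B \<ge> 2\<close> by (simp add: l_def power2_eq_square)
  moreover have "e / (2 * B) \<le> 1" using e \<open>B \<ge> 2\<close> by (simp add: divide_le_eq)
  ultimately have lB: "\<bar>l\<bar> * B \<le> 1" using \<open>l > 0\<close> by simp
  define c where "c = e\<^sup>2 / (4 * B\<^sup>2)"
  have "c > 0" using e \<open>B \<ge> 2\<close> by (simp add: c_def)
  have c: "(l * B)\<^sup>2 - l * e = - c"
    using \<open>B \<ge> 2\<close> by (simp add: l_def c_def power2_eq_square field_simps)
  have [measurable]: "mart f x n \<in> borel_measurable ?P" for n by (rule measurable_mart[OF f x])
  define A where "A = (\<lambda>n. {\<omega> \<in> space ?P. e * real n \<le> mart f x n \<omega>})"
  have [measurable]: "A n \<in> sets ?P" for n unfolding A_def by measurable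
  have A_le: "emeasure ?P (A n) \<le> ennreal (exp (- c) ^ n)" for n
  proof -
    have "A n = {\<omega> \<in> space ?P. 1 \<le> ennreal (exp (- l * e * real n)) * ennreal (exp (l * mart f x n \<omega>))}"
    proof -
      have "1 \<le> ennreal (exp (- l * e * real n)) * ennreal (exp (l * y)) \<longleftrightarrow> e * real n \<le> y" for y
      proof -
        have "ennreal (exp (- l * e * real n)) * ennreal (exp (l * y)) = ennreal (exp (l * (y - e * real n)))"
          by (simp add: algebra_simps flip: ennreal_mult exp_add)
        then show ?thesis using \<open>l > 0\<close> by (simp add: ennreal_1[symmetric] zero_le_mult_iff del: ennreal_1)
      qed
      then show ?thesis by (simp add: A_def)
    qed
    then have "emeasure ?P (A n) \<le> ennreal (exp (- l * e * real n)) * (\<integral>\<^sup>+\<omega>. ennreal (exp (l * mart f x n \<omega>)) * indicator (space ?P) \<omega> \<partial>?P)"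
      using nn_integral_Markov_inequality[of "\<lambda>\<omega>. ennreal (exp (l * mart f x n \<omega>))" "space ?P" ?P "ennreal (exp (- l * e * real n))"]
      by (simp add: Int_absorb2 Collect_conj_eq[symmetric])
    also have "\<dots> \<le> ennreal (exp (- l * e * real n)) * ennreal (exp (real n * (l * B)\<^sup>2))"
    proof (rule mult_left_mono)
      have "(\<integral>\<^sup>+\<omega>. ennreal (exp (l * mart f x n \<omega>)) * indicator (space ?P) \<omega> \<partial>?P)
          = (\<integral>\<^sup>+\<omega>. ennreal (exp (l * mart f x n \<omega>)) \<partial>?P)"
        by (rule nn_integral_cong) simp
      with nn_integral_exp_mart[OF f B lB x, of n]
      show "(\<integral>\<^sup>+\<omega>. ennreal (exp (l * mart f x n \<omega>)) * indicator (space ?P) \<omega> \<partial>?P)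
          \<le> ennreal (exp (real n * (l * B)\<^sup>2))" by simp
    qed simp
    also have "\<dots> = ennreal (exp (real n * ((l * B)\<^sup>2 - l * e)))"
    proof -
      have "- l * e * real n + real n * (l * B)\<^sup>2 = real n * ((l * B)\<^sup>2 - l * e)"
        by (simp add: algebra_simps)
      then show ?thesis by (simp flip: ennreal_mult exp_add)
    qed
    also have "\<dots> = ennreal (exp (- c) ^ n)" unfolding c by (simp only: exp_of_nat_mult)
    finally show ?thesis .
  qed
  have "summable (\<lambda>n. measure ?P (A n))"
  proof (rule summable_comparison_test)
    show "summable (\<lambda>n. exp (- c) ^ n)" using \<open>c > 0\<close> by (intro summable_geometric) simp
    show "\<exists>N. \<forall>n\<ge>N. norm (measure ?P (A n)) \<le> exp (- c) ^ n"
      using A_le by (auto simp: paths.emeasure_eq_measure)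
  qed
  then have "AE \<omega> in ?P. eventually (\<lambda>n. \<omega> \<in> space ?P - A n) sequentially"
    by (intro borel_cantelli_AE1) (simp_all add: paths.emeasure_eq_measure)
  then show ?thesis
    by eventually_elim (auto simp: A_def elim!: eventually_mono)
qed

text \<open>The one-sided bound is applied to \<open>f\<close> and to \<open>- f\<close>; the
  thresholds \<open>1 / Suc m\<close> keep the number of exceptional null sets countable.\<close>

lemma AE_mart_lln:
  assumes f: "continuous_on S1 f" and x: "x \<in> S1"
  shows "AE \<omega> in path_measure k p. (\<lambda>n. mart f x n \<omega> / real n) \<longlonglongrightarrow> 0"
proof -
  have "AE \<omega> in path_measure k p. \<forall>m. eventually (\<lambda>n. \<bar>mart f x n \<omega>\<bar> < 1 / real (Suc m) * real n) sequentially"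
    unfolding AE_all_countable
  proof
    fix m :: nat
    have e: "0 < 1 / real (Suc m)" "1 / real (Suc m) \<le> 1" by simp_all
    have "continuous_on S1 (\<lambda>y. - f y)" by (intro continuous_intros f)
    from AE_mart_less[OF f x e] AE_mart_less[OF this x e]
    show "AE \<omega> in path_measure k p. eventually (\<lambda>n. \<bar>mart f x n \<omega>\<bar> < 1 / real (Suc m) * real n) sequentially"
    proof eventually_elim
      case (elim \<omega>)
      from elim(1) elim(2) show ?case
        by eventually_elim (simp add: mart_minus abs_less_iff)
    qed
  qed
  then show ?thesis
  proof eventually_elim
    case (elim \<omega>)
    show ?case
    proof (rule tendstoI)
      fix e :: real assume "e > 0"
      then obtain m where m: "1 / real (Suc m) < e" by (rule nat_approx_posE)
      from elim[rule_format, of m] eventually_gt_at_top[of 0]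
      show "eventually (\<lambda>n. dist (mart f x n \<omega> / real n) 0 < e) sequentially"
      proof eventually_elim
        case (elim n)
        then have "\<bar>mart f x n \<omega>\<bar> / real n < 1 / real (Suc m)" by (simp add: field_simps)
        with m show ?case by (simp add: dist_real_def)
      qed
    qed
  qed
qed

end

section \<open>The law of large numbers\<close>

context circle_walk
begin

section \<open>Coboundaries and Birkhoff averages\<close>

lemma continuous_on_U_funpow: "continuous_on S1 f \<Longrightarrow> continuous_on S1 ((U ^^ j) f)"
proof (induction j)
  case (Suc j) then show ?case using continuous_on_U by (simp del: One_nat_def)
qed simp

text \<open>The martingale pairs \<open>f\<close> at time \<open>j + 1\<close> with
  \<open>U f\<close> at time \<open>j\<close>; shifting the second sum by one step leaves two
  boundary terms.\<close>

lemma sum_coboundary: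
  "(\<Sum>j=1..n. f (word_comp g \<omega> j x) - U f (word_comp g \<omega> j x))
    = mart f x n \<omega> + U f x - U f (word_comp g \<omega> n x)"
  by (induction n) (simp_all add: mart_def)

text \<open>Along an orbit a coboundary sums to a martingale plus a bounded term, hence averages to
  0. Countably many approximations, with errors \<open>1 / Suc m\<close>, suffice.\<close>

lemma AE_birkhoff_average:
  assumes \<phi>: "\<And>e. 0 < e \<Longrightarrow> \<exists>f. continuous_on S1 f \<and> (\<forall>y\<in>S1. \<bar>\<phi> y - c - (f y - U f y)\<bar> \<le> e)"
    and x: "x \<in> S1"
  shows "AE \<omega> in path_measure k p. (\<lambda>n. (\<Sum>j=1..n. \<phi> (word_comp g \<omega> j x)) / real n) \<longlonglongrightarrow> c"
proof -
  have "\<exists>f. continuous_on S1 f \<and> (\<forall>y\<in>S1. \<bar>\<phi> y - c - (f y - U f y)\<bar> \<le> 1 / real (Suc m))" for m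
    by (rule \<phi>) simp
  then obtain f where f: "\<And>m. continuous_on S1 (f m)"
    "\<And>m y. y \<in> S1 \<Longrightarrow> \<bar>\<phi> y - c - (f m y - U (f m) y)\<bar> \<le> 1 / real (Suc m)"
    by metis
  have "AE \<omega> in path_measure k p. \<forall>m. (\<lambda>n. mart (f m) x n \<omega> / real n) \<longlonglongrightarrow> 0"
    unfolding AE_all_countable using AE_mart_lln[OF f(1) x] by blast
  then show ?thesis
    using AE_space
  proof eventually_elim
    case (elim \<omega>)
    let ?X = "\<lambda>j. word_comp g \<omega> j x"
    have X: "?X j \<in> S1" for j using word_comp_S1[OF path_in[OF elim(2)] x] .
    show ?case
    proof (rule tendstoI)
      fix e :: real assume "e > 0"
      then have "e / 2 > 0" by simp
      then obtain m where m: "1 / real (Suc m) < e / 2" by (rule nat_approx_posE)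
      obtain B where B: "\<And>y. y \<in> S1 \<Longrightarrow> \<bar>U (f m) y\<bar> \<le> B"
        using bounded_on_S1[OF continuous_on_U[OF f(1)]] by metis
      have "(\<lambda>n. \<bar>mart (f m) x n \<omega> / real n\<bar> + 2 * B / real n) \<longlonglongrightarrow> \<bar>0\<bar> + 0"
        by (intro tendsto_add tendsto_rabs elim(1)[rule_format]) real_asymp
      then have "eventually (\<lambda>n. \<bar>mart (f m) x n \<omega> / real n\<bar> + 2 * B / real n < e / 2) sequentially"
        using \<open>e / 2 > 0\<close> by (intro order_tendstoD(2)) auto
      then show "eventually (\<lambda>n. dist ((\<Sum>j=1..n. \<phi> (?X j)) / real n) c < e) sequentially"
        using eventually_gt_at_top[of 0]
      proof eventually_elim
        case (elim n)
        let ?d = "\<Sum>j=1..n. \<phi> (?X j) - c - (f m (?X j) - U (f m) (?X j))"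
        have "\<bar>?d\<bar> \<le> (\<Sum>j=1..n. 1 / real (Suc m))"
          by (intro order_trans[OF sum_abs] sum_mono f(2) X)
        then have d: "\<bar>?d\<bar> \<le> real n * (1 / real (Suc m))" by simp
        have "(\<Sum>j=1..n. \<phi> (?X j)) - real n * c
            = ?d + (mart (f m) x n \<omega> + U (f m) x - U (f m) (?X n))"
          unfolding sum_coboundary[symmetric] by (simp add: sum_subtractf)
        then have "\<bar>(\<Sum>j=1..n. \<phi> (?X j)) - real n * c\<bar>
            \<le> real n * (1 / real (Suc m)) + \<bar>mart (f m) x n \<omega>\<bar> + 2 * B"
          using d B[OF x] B[OF X[of n]] by linarith
        then have "\<bar>(\<Sum>j=1..n. \<phi> (?X j)) - real n * c\<bar> / real n
            \<le> (real n * (1 / real (Suc m)) + \<bar>mart (f m) x n \<omega>\<bar> + 2 * B) / real n"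
          by (rule divide_right_mono) simp
        also have "\<dots> = 1 / real (Suc m) + (\<bar>mart (f m) x n \<omega> / real n\<bar> + 2 * B / real n)"
          using elim(2) by (simp add: add_divide_distrib abs_divide)
        also have "\<dots> < e" using elim(1) m by linarith
        finally have "\<bar>(\<Sum>j=1..n. \<phi> (?X j)) - real n * c\<bar> / real n < e" .
        then have "\<bar>((\<Sum>j=1..n. \<phi> (?X j)) - real n * c) / real n\<bar> < e"
          by (simp add: abs_divide)
        moreover have "((\<Sum>j=1..n. \<phi> (?X j)) - real n * c) / real n = (\<Sum>j=1..n. \<phi> (?X j)) / real n - c"
          using elim(2) by (simp add: diff_divide_distrib)
        ultimately show ?case by (simp only: dist_real_def diff_0_right)
      qed
    qed
  qed
qed

text \<open>Each \<open>\<phi> - U^j \<phi>\<close> telescopes into a coboundary of the partial sum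
  of iterates below \<open>j\<close>; \<open>f\<close> is the average of these partial sums.\<close>

lemma cesaro_coboundary:
  assumes "n \<ge> 1" "continuous_on S1 \<phi>"
  obtains f where "continuous_on S1 f" "\<And>y. \<phi> y - cesaro {1..k} p g n \<phi> y = f y - U f y"
proof
  define f where "f = (\<lambda>y. (\<Sum>j<n. \<Sum>l<j. (U ^^ l) \<phi> y) / real n)"
  show "continuous_on S1 f"
    unfolding f_def using assms(1)
    by (intro continuous_on_divide continuous_on_sum continuous_on_const continuous_on_U_funpow assms(2)) auto
  show "\<phi> y - cesaro {1..k} p g n \<phi> y = f y - U f y" for y
  proof -
    have "f y - U f y = (\<Sum>j<n. \<Sum>l<j. (U ^^ l) \<phi> y - (U ^^ Suc l) \<phi> y) / real n"
      unfolding f_def avg_op_divide avg_op_sum by (simp add: sum_subtractf diff_divide_distrib)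
    also have "\<dots> = (\<Sum>j<n. \<phi> y - (U ^^ j) \<phi> y) / real n"
      unfolding sum_lessThan_telescope'[of "\<lambda>l. (U ^^ l) \<phi> y"] by simp
    also have "\<dots> = \<phi> y - cesaro {1..k} p g n \<phi> y"
      using assms(1) by (simp add: cesaro_def sum_subtractf diff_divide_distrib)
    finally show ?thesis by simp
  qed
qed

section \<open>The invariant measure and the averaging operator\<close>

context
  fixes \<mu> :: "complex measure"
  assumes \<mu>: "prob_space \<mu>" "sets \<mu> = sets borel_S1" "markov_op k g p \<mu> = \<mu>"
begin

interpretation \<mu>: prob_space \<mu> by (rule \<mu>(1))

lemma space_inv: "space \<mu> = S1"
  using sets_eq_imp_space_eq[OF \<mu>(2)] by (simp add: space_borel_S1)

lemma integrable_S1: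
  assumes "continuous_on S1 (f :: complex \<Rightarrow> real)"
  shows "integrable \<mu> f"
proof -
  obtain B where "\<And>y. y \<in> S1 \<Longrightarrow> \<bar>f y\<bar> \<le> B" using bounded_on_S1[OF assms] by metis
  then show ?thesis
    using measurable_S1[OF assms] measurable_cong_sets[OF \<mu>(2) refl]
    by (intro \<mu>.integrable_const_bound[of _ B]) (auto simp: space_inv)
qed

lemma measurable_step: "(\<lambda>(i, y). g i y) \<in> index_dist k p \<Otimes>\<^sub>M \<mu> \<rightarrow>\<^sub>M borel_S1"
proof -
  have "(\<lambda>(i, y). g i y) \<in> count_space {1..k} \<Otimes>\<^sub>M borel_S1 \<rightarrow>\<^sub>M borel_S1"
    by (rule measurable_pair_measure_countable1) (auto intro: measurable_g)
  then show ?thesis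
    by (simp add: measurable_cong_sets[OF sets_pair_measure_cong[OF sets_index_dist \<mu>(2)] refl])
qed

text \<open>Invariance restated: a point with law \<open>\<mu>\<close>, moved by an independent
  random map, keeps its law. This form allows Fubini for integrals of real functions.\<close>

lemma distr_step: "distr (index_dist k p \<Otimes>\<^sub>M \<mu>) borel_S1 (\<lambda>(i, y). g i y) = \<mu>"
proof (rule measure_eqI)
  fix A assume "A \<in> sets (distr (index_dist k p \<Otimes>\<^sub>M \<mu>) borel_S1 (\<lambda>(i, y). g i y))"
  then have A: "A \<in> sets borel_S1" by simp
  note [measurable] = measurable_step A
  have g': "g i \<in> \<mu> \<rightarrow>\<^sub>M borel_S1" if "i \<in> {1..k}" for i
    using measurable_g[OF that] measurable_cong_sets[OF \<mu>(2) refl] by blast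
  have "emeasure (distr (index_dist k p \<Otimes>\<^sub>M \<mu>) borel_S1 (\<lambda>(i, y). g i y)) A
      = (\<integral>\<^sup>+z. indicator A (case z of (i, y) \<Rightarrow> g i y) \<partial>(index_dist k p \<Otimes>\<^sub>M \<mu>))"
    using A by (subst nn_integral_distr[symmetric, OF measurable_step]) auto
  also have "\<dots> = (\<integral>\<^sup>+i. \<integral>\<^sup>+y. indicator A (g i y) \<partial>\<mu> \<partial>index_dist k p)"
    by (subst \<mu>.nn_integral_fst[symmetric]) simp_all
  also have "\<dots> = (\<Sum>i\<in>{1..k}. ennreal (p i) * (\<integral>\<^sup>+y. indicator A (g i y) \<partial>\<mu>))"
    unfolding index_dist_def by (subst nn_integral_point_measure_finite) (auto simp: mult.commute)
  also have "\<dots> = (\<Sum>i\<in>{1..k}. ennreal (p i) * emeasure (distr \<mu> borel_S1 (g i)) A)"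
  proof (intro sum.cong refl arg_cong2[where f="(*)"])
    fix i assume "i \<in> {1..k}"
    then show "(\<integral>\<^sup>+y. indicator A (g i y) \<partial>\<mu>) = emeasure (distr \<mu> borel_S1 (g i)) A"
      using A by (subst nn_integral_distr[symmetric, OF g']) auto
  qed
  also have "\<dots> = emeasure \<mu> A" using emeasure_markov_op[OF A, of k g p \<mu>] \<mu>(3) by simp
  finally show "emeasure (distr (index_dist k p \<Otimes>\<^sub>M \<mu>) borel_S1 (\<lambda>(i, y). g i y)) A = emeasure \<mu> A" .
qed (simp add: \<mu>(2))

text \<open>Duality of \<open>U\<close> with \<open>markov_op\<close>, obtained by computing one
  integral over the product measure in two ways.\<close>

lemma integral_U:
  assumes f: "continuous_on S1 f"
  shows "(\<integral>y. U f y \<partial>\<mu>) = (\<integral>y. f y \<partial>\<mu>)"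
proof -
  interpret I: prob_space "index_dist k p" by (rule prob_index_dist)
  interpret pair: pair_prob_space "index_dist k p" \<mu> ..
  obtain B where B: "\<And>y. y \<in> S1 \<Longrightarrow> \<bar>f y\<bar> \<le> B" using bounded_on_S1[OF f] by metis
  have fm: "f \<in> borel_measurable borel_S1" by (rule measurable_S1[OF f])
  have int: "integrable (index_dist k p \<Otimes>\<^sub>M \<mu>) (\<lambda>(i, y). f (g i y))"
  proof (rule pair.integrable_const_bound[of _ B])
    show "AE z in index_dist k p \<Otimes>\<^sub>M \<mu>. norm (case z of (i, y) \<Rightarrow> f (g i y)) \<le> B"
      using B g_S1 by (intro AE_I2) (auto simp: space_pair_measure space_index_dist space_inv)
    show "(\<lambda>(i, y). f (g i y)) \<in> borel_measurable (index_dist k p \<Otimes>\<^sub>M \<mu>)"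
      using measurable_compose[OF measurable_step fm] by (simp add: case_prod_beta)
  qed
  have int_i: "integrable \<mu> (\<lambda>y. f (g i y))" if "i \<in> {1..k}" for i
    using g_S1[OF that] by (intro integrable_S1 continuous_on_compose2[OF f g_cont[OF that]]) auto
  have "(\<integral>y. f y \<partial>\<mu>) = (\<integral>y. f y \<partial>distr (index_dist k p \<Otimes>\<^sub>M \<mu>) borel_S1 (\<lambda>(i, y). g i y))"
    unfolding distr_step ..
  also have "\<dots> = (\<integral>z. (case z of (i, y) \<Rightarrow> f (g i y)) \<partial>(index_dist k p \<Otimes>\<^sub>M \<mu>))"
    by (subst integral_distr[OF measurable_step fm]) (simp add: case_prod_unfold)
  also have "\<dots> = (\<integral>i. \<integral>y. f (g i y) \<partial>\<mu> \<partial>index_dist k p)"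
    using pair.integral_fst'[OF int] by simp
  also have "\<dots> = (\<Sum>i\<in>{1..k}. p i * (\<integral>y. f (g i y) \<partial>\<mu>))"
    unfolding index_dist_def using p_nonneg by (subst lebesgue_integral_point_measure_finite) auto
  also have "\<dots> = (\<integral>y. U f y \<partial>\<mu>)"
    unfolding avg_op_def using int_i by (subst Bochner_Integration.integral_sum) auto
  finally show ?thesis by simp
qed

lemma integral_cesaro:
  assumes "continuous_on S1 f" "n \<ge> 1"
  shows "(\<integral>y. cesaro {1..k} p g n f y \<partial>\<mu>) = (\<integral>y. f y \<partial>\<mu>)"
proof -
  have cont: "continuous_on S1 ((U ^^ j) f)" for j by (rule continuous_on_U_funpow[OF assms(1)])
  have "(\<integral>y. (U ^^ j) f y \<partial>\<mu>) = (\<integral>y. f y \<partial>\<mu>)" for j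
    by (induction j) (simp_all add: integral_U[OF cont] del: One_nat_def)
  then show ?thesis
    using assms(2) unfolding cesaro_def
    by (subst integral_divide_zero, subst Bochner_Integration.integral_sum) (simp_all add: integrable_S1[OF cont] del: One_nat_def)
qed

text \<open>The Cesaro mean has the same integral as \<open>f\<close>, so this integral is also
  within \<open>e\<close> of \<open>c\<close>.\<close>

lemma cesaro_near_integral:
  assumes "continuous_on S1 f" "n \<ge> 1" "\<And>y. y \<in> S1 \<Longrightarrow> \<bar>cesaro {1..k} p g n f y - c\<bar> \<le> e" "y \<in> S1"
  shows "\<bar>cesaro {1..k} p g n f y - (\<integral>y. f y \<partial>\<mu>)\<bar> \<le> 2 * e"
proof -
  have cont: "continuous_on S1 ((U ^^ j) f)" for j by (rule continuous_on_U_funpow[OF assms(1)])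
  have int: "integrable \<mu> (cesaro {1..k} p g n f)"
    unfolding cesaro_def using assms(2)
    by (intro integrable_S1 continuous_on_divide continuous_on_sum continuous_on_const cont) auto
  have bounds: "cesaro {1..k} p g n f z \<le> c + e" "c - e \<le> cesaro {1..k} p g n f z" if "z \<in> space \<mu>" for z
    using assms(3)[of z] that unfolding space_inv by linarith+
  have "(\<integral>y. f y \<partial>\<mu>) \<le> c + e" "c - e \<le> (\<integral>y. f y \<partial>\<mu>)"
    unfolding integral_cesaro[OF assms(1,2), symmetric]
    using \<mu>.integral_le_const[OF int AE_I2[OF bounds(1)]] \<mu>.integral_ge_const[OF int AE_I2[OF bounds(2)]]
    by simp_all
  with assms(3)[OF assms(4)] show ?thesis by linarith
qed

end

end

section \<open>Passage from the circle to the lifts, and conclusion\<close>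

lemma orientation_preserving_lift:
  assumes "orientation_preserving_homeo g"
  obtains G where "circle_lift G" "\<And>t. g (circ t) = circ (G t)"
  using assms unfolding orientation_preserving_homeo_def circle_lift_def circ_def by auto

lemma orientation_preserving_continuous:
  assumes "orientation_preserving_homeo g"
  shows "continuous_on S1 g" "\<And>y. y \<in> S1 \<Longrightarrow> g y \<in> S1"
  using assms unfolding orientation_preserving_homeo_def homeomorphism_def by blast+

theorem proposition16:
  fixes k :: nat
    and g :: "nat \<Rightarrow> complex \<Rightarrow> complex"
    and p :: "nat \<Rightarrow> real"
    and \<mu> :: "complex measure"
    and \<phi> :: "complex \<Rightarrow> real"
  assumes "\<And>i. i \<in> {1..k} \<Longrightarrow> orientation_preserving_homeo (g i)"
    and "admissible k g"
    and "\<And>i. i \<in> {1..k} \<Longrightarrow> p i > 0"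
    and "(\<Sum>i\<in>{1..k}. p i) = 1"
    and "prob_space \<mu>"
    and "sets \<mu> = sets borel_S1"
    and "markov_op k g p \<mu> = \<mu>"
    and "continuous_on S1 \<phi>"
  shows "\<forall>x\<in>S1. \<exists>\<Omega>'\<in>sets (path_measure k p).
           emeasure (path_measure k p) \<Omega>' = 1 \<and>
           (\<forall>\<omega>\<in>\<Omega>'. (\<lambda>n. (\<Sum>j=1..n. \<phi> (word_comp g \<omega> j x)) / real n)
              \<longlonglongrightarrow> (\<integral>y. (\<integral>i. \<phi> y \<partial>index_dist k p) \<partial>\<mu>))"
proof
  fix x assume x: "x \<in> S1"
  let ?I = "{1..k}"
  interpret circle_walk k g p
    by unfold_locales (use assms(1,3,4) orientation_preserving_continuous in \<open>auto simp del: mem_sphere intro: less_imp_le\<close>)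
  have "\<exists>G. circle_lift G \<and> (\<forall>t. g i (circ t) = circ (G t))" if "i \<in> ?I" for i
    using orientation_preserving_lift[OF assms(1)[OF that]] by metis
  then obtain G where G: "\<And>i. i \<in> ?I \<Longrightarrow> circle_lift (G i)"
    "\<And>i t. i \<in> ?I \<Longrightarrow> g i (circ t) = circ (G i t)"
    by metis
  obtain i0 x0 where i0: "i0 \<in> ?I" "x0 \<in> S1" "S1 \<subseteq> closure {(g i0 ^^ n) x0 | n. n \<ge> 1}"
    using assms(2) unfolding admissible_def by blast
  interpret walk: transitive_walk "g i0" G i0 x0 ?I p
    by unfold_locales (use G i0 assms(3,4) in \<open>auto simp del: mem_sphere\<close>)
  define f where "f = (\<lambda>t. \<phi> (circ t))"
  have f: "continuous_on UNIV f" "\<And>t. f (t + 1) = f t"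
    unfolding f_def using circ_add_int[of _ 1]
    by (auto intro!: continuous_on_compose2[OF assms(8) continuous_on_circ])
  \<comment> \<open>Composition with the covering map intertwines averaging over the
    \<open>g i\<close> with averaging over the lifts, so estimates on the line descend to the
    circle.\<close>
  have U_circ: "(avg_op ?I p g ^^ j) \<phi> (circ t) = (avg_op ?I p G ^^ j) f t" for j t
  proof (induction j arbitrary: t)
    case (Suc j)
    then have "avg_op ?I p g ((avg_op ?I p g ^^ j) \<phi>) (circ t) = avg_op ?I p G ((avg_op ?I p G ^^ j) f) t"
      unfolding avg_op_def[where f="(avg_op ?I p g ^^ j) \<phi>"] avg_op_def[where f="(avg_op ?I p G ^^ j) f"]
      by (intro sum.cong) (simp_all add: G(2))
    then show ?case by simp
  qed (simp add: f_def)
  have "AE \<omega> in path_measure k p. (\<lambda>n. (\<Sum>j=1..n. \<phi> (word_comp g \<omega> j x)) / real n) \<longlonglongrightarrow> (\<integral>y. \<phi> y \<partial>\<mu>)"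
  proof (rule AE_birkhoff_average[OF _ x])
    fix e :: real assume "e > 0"
    then have "e / 2 > 0" by simp
    from walk.cesaro_nearly_constant[OF f this] obtain n c
      where n: "n \<ge> 1" "\<And>t. \<bar>cesaro ?I p G n f t - c\<bar> \<le> e / 2" by metis
    have "\<bar>cesaro ?I p g n \<phi> y - c\<bar> \<le> e / 2" if y: "y \<in> S1" for y
    proof -
      obtain t where "y = circ t" using S1_circ[OF y] by metis
      moreover have "cesaro ?I p g n \<phi> (circ t) = cesaro ?I p G n f t"
        by (simp only: cesaro_def U_circ)
      ultimately show ?thesis using n(2)[of t] by simp
    qed
    from cesaro_near_integral[OF assms(5-7) assms(8) n(1) this]
    have near: "\<bar>cesaro ?I p g n \<phi> y - (\<integral>y. \<phi> y \<partial>\<mu>)\<bar> \<le> e" if "y \<in> S1" for y using that by simp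
    obtain h where "continuous_on S1 h" "\<And>y. \<phi> y - cesaro ?I p g n \<phi> y = h y - U h y"
      using cesaro_coboundary[OF n(1) assms(8)] by metis
    note h = this
    have "\<phi> y - (\<integral>y. \<phi> y \<partial>\<mu>) - (h y - U h y) = cesaro ?I p g n \<phi> y - (\<integral>y. \<phi> y \<partial>\<mu>)" for y
      using h(2)[of y] by linarith
    then have "\<bar>\<phi> y - (\<integral>y. \<phi> y \<partial>\<mu>) - (h y - U h y)\<bar> \<le> e" if "y \<in> S1" for y
      using near[OF that] by (simp only:)
    with h(1) show "\<exists>h. continuous_on S1 h \<and> (\<forall>y\<in>S1. \<bar>\<phi> y - (\<integral>y. \<phi> y \<partial>\<mu>) - (h y - U h y)\<bar> \<le> e)"
      by blast
  qed
  \<comment> \<open>The inner integrand is constant in the index, and the weights have total mass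
    1.\<close>
  moreover have "(\<integral>i. \<phi> y \<partial>index_dist k p) = \<phi> y" for y
    using prob_space.prob_space[OF prob_index_dist] by simp
  ultimately have "AE \<omega> in path_measure k p. (\<lambda>n. (\<Sum>j=1..n. \<phi> (word_comp g \<omega> j x)) / real n)
      \<longlonglongrightarrow> (\<integral>y. (\<integral>i. \<phi> y \<partial>index_dist k p) \<partial>\<mu>)"
    by (simp only:)
  \<comment> \<open>The set of full measure will be the complement of a measurable null set
    containing all exceptional paths.\<close>
  then obtain N where N: "N \<in> null_sets (path_measure k p)"
    "{\<omega> \<in> space (path_measure k p). \<not> (\<lambda>n. (\<Sum>j=1..n. \<phi> (word_comp g \<omega> j x)) / real n)
      \<longlonglongrightarrow> (\<integral>y. (\<integral>i. \<phi> y \<partial>index_dist k p) \<partial>\<mu>)} \<subseteq> N"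
    unfolding eventually_ae_filter by blast
  show "\<exists>\<Omega>'\<in>sets (path_measure k p). emeasure (path_measure k p) \<Omega>' = 1 \<and>
      (\<forall>\<omega>\<in>\<Omega>'. (\<lambda>n. (\<Sum>j=1..n. \<phi> (word_comp g \<omega> j x)) / real n)
        \<longlonglongrightarrow> (\<integral>y. (\<integral>i. \<phi> y \<partial>index_dist k p) \<partial>\<mu>))"
  proof (intro bexI conjI ballI)
    show "space (path_measure k p) - N \<in> sets (path_measure k p)" using N(1) by auto
    show "emeasure (path_measure k p) (space (path_measure k p) - N) = 1"
      using N(1) by (simp add: emeasure_Diff_null_set paths.emeasure_space_1)
  qed (use N(2) in blast)
qed

end
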